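(* Consider the condition $$(\ast)\qquad \alpha>0\ \text{ and }\ \int^{+\infty}r\ln r\,\pi(\mathrm{d}r)<+\infty .$$ If $(\ast)$ holds, then $V_q$ converges in distribution as $q\to+\infty$ to a positive random variable $V_\infty$. The distribution of $V_\infty$ has the following properties. (i) It is of the size-biased Yaglom distribution $\mathrm{P}(V_\infty\in\mathrm{d}r)=\dfrac{r\,\mathrm{P}(\Theta\in\mathrm{d}r)}{\mathrm{E}[\Theta]}$. (ii) It is infinitely divisible. (iii) Its Laplace exponent $l_\infty(\lambda):=-\ln\mathrm{E}[e^{-\lambda V_\infty}]$ is given by $l_\infty(\lambda)=\int_0^\lambda\frac{\psi'(s)-\alpha}{\psi(s)}\,\mathrm{d}s$, $\lambda>0$. (iv) $l_\infty(\lambda)$ has the Lévy--Khintchine decomposition $l_\infty(\lambda)=b_\infty\lambda+\int_0^{+\infty}(1-e^{-\lambda x})\frac{v_\infty(x)}{x}\,\mathrm{d}x$, where $b_\infty=0$ and $$v_\infty(x)=\sigma^2W'(x)+\int_0^{+\infty}\left(W(x)-W(x-r)\right)r\,\pi(\mathrm{d}r),\qquad x>0.$$ Otherwise, if $(\ast)$ fails, then $V_q$ converges in probability as $q\to+\infty$ to infinity.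
   Context: Branching mechanism: $\psi(\lambda)=\alpha\lambda+\frac12\sigma^2\lambda^2+\int_0^{+\infty}(e^{-\lambda r}-1+\lambda r)\,\pi(\mathrm{d}r)$, $\lambda\ge 0$, where $\alpha\ge 0$, $\sigma\ge 0$ and $\pi$ is a positive Radon measure on $(0,+\infty)$ with $\int_0^{+\infty}(r\wedge r^2)\,\pi(\mathrm{d}r)<+\infty$. It is assumed that $\psi(+\infty)=+\infty$ and $\int^{+\infty}\frac{1}{\psi(\lambda)}\,\mathrm{d}\lambda<+\infty$. The notation $\int^{+\infty}$ means integrability at $+\infty$ (integral over $[c,+\infty)$ for some $c>1$). $\phi(\lambda):=\int_\lambda^{+\infty}\frac{1}{\psi(u)}\,\mathrm{d}u$ for $\lambda>0$, which is a strictly decreasing bijection of $(0,+\infty)$, and $\varphi:(0,+\infty)\to(0,+\infty)$ is its inverse function. Scale function: $W$ is the unique strictly increasing, nonnegative, continuous function on $[0,+\infty)$ with $\int_0^{+\infty}e^{-\lambda x}W(x)\,\mathrm{d}x=\frac1{\psi(\lambda)}$ for all $\lambda>0$; $W(x):=0$ for $x<0$. Under the present assumptions $W(0)=0$ and $W$ is continuously differentiable on $(0,+\infty)$, with derivative $W'$. For $q>0$, $V_q$ is the positive random variable whose law is determined by $$\mathrm{E}\left[e^{-\lambda V_q}\right]=e^{-\alpha(\phi(\lambda+\varphi(q))-q)}\,\frac{\psi(\varphi(q))}{\psi(\lambda+\varphi(q))},\qquad\lambda>0.$$ (It is the limit law as $t\to+\infty$ of $Z_{t-q}$ conditioned on extinction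 at time $t$, for the continuous-state branching process $Z$ with branching mechanism $\psi$.) When $\alpha>0$, $\Theta$ is a positive random variable distributed according to the Yaglom distribution $\nu_\alpha$, the probability measure on $(0,+\infty)$ determined by $\mathrm{E}[e^{-\lambda\Theta}]=1-e^{-\alpha\phi(\lambda)}$ for all $\lambda>0$. Convergence in probability to infinity means $\mathrm{P}(V_q>M)\to1$ for every $M>0$. *)

theory Defs
  imports "HOL-Probability.Probability"
begin

text \<open>
  Measures on \<open>(0, \<infinity>)\<close> are represented as Borel measures on the real line giving no mass to
  \<open>(-\<infinity>, 0]\<close>.
\<close>

definition integrable_at_infinity :: "real measure \<Rightarrow> (real \<Rightarrow> real) \<Rightarrow> bool" where
  "integrable_at_infinity M f \<longleftrightarrow> (\<exists>c>1. set_integrable M {c..} f)"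

definition psi :: "real \<Rightarrow> real \<Rightarrow> real measure \<Rightarrow> real \<Rightarrow> real" where
  "psi \<alpha> \<sigma> \<pi> u = \<alpha> * u + 1 / 2 * \<sigma>\<^sup>2 * u\<^sup>2 + (LINT r:{0<..}|\<pi>. exp (- u * r) - 1 + u * r)"

text \<open>
  On \<open>(0, \<infinity>)\<close> a Borel measure is Radon as soon as it is finite on compact sets.
\<close>

locale branching_mechanism =
  fixes \<alpha> \<sigma> :: real and \<pi> :: "real measure"
  assumes alpha_nonneg: "0 \<le> \<alpha>"
    and sigma_nonneg: "0 \<le> \<sigma>"
    and sets_pi: "sets \<pi> = sets borel"
    and pi_nonpos: "emeasure \<pi> {..0} = 0"
    and pi_radon: "\<And>K. compact K \<Longrightarrow> K \<subseteq> {0<..} \<Longrightarrow> emeasure \<pi> K < \<infinity>"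
    and pi_integrable: "set_integrable \<pi> {0<..} (\<lambda>r. min r (r\<^sup>2))"
    and psi_at_top: "filterlim (psi \<alpha> \<sigma> \<pi>) at_top at_top"
    and inverse_psi_integrable: "integrable_at_infinity lborel (\<lambda>u. 1 / psi \<alpha> \<sigma> \<pi> u)"

definition phi :: "real \<Rightarrow> real \<Rightarrow> real measure \<Rightarrow> real \<Rightarrow> real" where
  "phi \<alpha> \<sigma> \<pi> s = (LINT u:{s..}|lborel. 1 / psi \<alpha> \<sigma> \<pi> u)"

definition varphi :: "real \<Rightarrow> real \<Rightarrow> real measure \<Rightarrow> real \<Rightarrow> real" where
  "varphi \<alpha> \<sigma> \<pi> = the_inv_into {0<..} (phi \<alpha> \<sigma> \<pi>)"

definition scale_function :: "(real \<Rightarrow> real) \<Rightarrow> (real \<Rightarrow> real) \<Rightarrow> bool" where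
  "scale_function \<psi> W \<longleftrightarrow>
     strict_mono_on {0..} W \<and> (\<forall>x\<ge>0. 0 \<le> W x) \<and> continuous_on {0..} W \<and>
     (\<forall>u>0. set_integrable lborel {0..} (\<lambda>x. exp (- u * x) * W x) \<and>
            (LINT x:{0..}|lborel. exp (- u * x) * W x) = 1 / \<psi> u) \<and>
     (\<forall>x<0. W x = 0)"

definition positive_random_variable :: "'a measure \<Rightarrow> ('a \<Rightarrow> real) \<Rightarrow> bool" where
  "positive_random_variable M X \<longleftrightarrow>
     prob_space M \<and> X \<in> borel_measurable M \<and> (AE \<omega> in M. 0 < X \<omega>)"

text \<open>
  The analogue of \<^const>\<open>weak_conv_m\<close> for a family of laws indexed by a real parameter
  tending to infinity.
\<close>

definition weak_conv_at_top :: "(real \<Rightarrow> real measure) \<Rightarrow> real measure \<Rightarrow> bool" where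
  "weak_conv_at_top L \<mu> \<longleftrightarrow>
     (\<forall>x. isCont (cdf \<mu>) x \<longrightarrow> ((\<lambda>q. cdf (L q) x) \<longlongrightarrow> cdf \<mu> x) at_top)"

definition infinitely_divisible :: "real measure \<Rightarrow> bool" where
  "infinitely_divisible \<mu> \<longleftrightarrow>
     (\<forall>n::nat\<ge>1. \<exists>\<nu>. real_distribution \<nu> \<and>
        distr (PiM {..<n::nat} (\<lambda>_. \<nu>)) borel (\<lambda>x. \<Sum>i<n. x i) = \<mu>)"

definition laplace_exponent :: "real measure \<Rightarrow> real \<Rightarrow> real" where
  "laplace_exponent \<mu> u = - ln (LINT r|\<mu>. exp (- u * r))"

text \<open>
  Levy--Khintchine decomposition, with drift \<open>b\<close> and a Levy measure having density \<open>m\<close>, of the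
  Laplace exponent \<open>l\<close> of a positive random variable.
\<close>

definition levy_khintchine :: "(real \<Rightarrow> real) \<Rightarrow> real \<Rightarrow> (real \<Rightarrow> real) \<Rightarrow> bool" where
  "levy_khintchine l b m \<longleftrightarrow>
     0 \<le> b \<and> (\<forall>x>0. 0 \<le> m x) \<and> set_integrable lborel {0<..} (\<lambda>x. min 1 x * m x) \<and>
     (\<forall>u>0. l u = b * u + (LINT x:{0<..}|lborel. (1 - exp (- u * x)) * m x))"

definition v_infinity ::
  "real \<Rightarrow> real measure \<Rightarrow> (real \<Rightarrow> real) \<Rightarrow> (real \<Rightarrow> real) \<Rightarrow> real \<Rightarrow> real" where
  "v_infinity \<sigma> \<pi> W W' x = \<sigma>\<^sup>2 * W' x + (LINT r:{0<..}|\<pi>. (W x - W (x - r)) * r)"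

definition log_condition :: "real \<Rightarrow> real measure \<Rightarrow> bool" where
  "log_condition \<alpha> \<pi> \<longleftrightarrow> \<alpha> > 0 \<and> integrable_at_infinity \<pi> (\<lambda>r. r * ln r)"

end

theory Submission
  imports Defs
begin

text \<open>
  Write \<open>\<rho> = (\<psi>' - \<alpha>) / \<psi>\<close>, which is nonnegative because \<open>\<psi>\<close> is convex with
  \<open>\<psi>'(0+) = \<alpha>\<close>.  The function \<open>h = ln \<psi> + \<alpha> \<phi>\<close> is a primitive of \<open>\<rho>\<close> on
  \<open>(0, \<infinity>)\<close>; below, \<open>\<rho>\<close> and \<open>h\<close> are called \<open>exponent_rate\<close> and \<open>exponent_potential\<close>.  Since
  \<open>\<phi>(\<varphi>(q)) = q\<close>, the given Laplace transform of \<open>V\<^sub>q\<close> is nothing but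
  \<open>exp (h(\<epsilon>) - h(s + \<epsilon>))\<close> with \<open>\<epsilon> = \<varphi>(q)\<close>, and \<open>\<epsilon> \<rightarrow> 0\<close> as \<open>q \<rightarrow> \<infinity>\<close>.  As \<open>h\<close> is
  nondecreasing, everything depends on whether it has a finite limit \<open>h\<^sub>0\<close> at \<open>0\<close>, that is, on
  whether \<open>\<rho>\<close> is integrable at \<open>0\<close>.

  This is exactly the condition of the theorem (\<open>log_condition_iff\<close>).  If \<open>\<alpha> = 0\<close>, then
  \<open>h = ln \<psi> \<rightarrow> -\<infinity>\<close>.  If \<open>\<alpha> > 0\<close>, then \<open>\<psi>(u)\<close> is comparable to \<open>u\<close> near \<open>0\<close>, and
  Tonelli's theorem reduces the question to \<open>\<integral> r j(r) \<pi>(dr) < \<infinity>\<close> where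
  \<open>j(r) = \<integral>\<^sub>0\<^sup>1 (1 - exp (- u r)) / u du\<close> lies between \<open>ln (1 + r)\<close> and \<open>2 ln (1 + r)\<close>.

  If the condition fails, the Laplace transforms of \<open>V\<^sub>q\<close> tend to \<open>0\<close>, so that \<open>V\<^sub>q\<close> tends
  to infinity in probability.  If it holds, they tend to \<open>exp (h\<^sub>0 - h(s))\<close>.  This function is the
  Laplace transform of the size-biased Yaglom distribution: differentiating
  \<open>E[exp (- s \<Theta>)] = 1 - exp (- \<alpha> \<phi>(s))\<close> gives
  \<open>E[\<Theta> exp (- s \<Theta>)] = \<alpha> exp (- h(s))\<close>, and \<open>s \<rightarrow> 0\<close> gives \<open>E[\<Theta>] = \<alpha> exp (- h\<^sub>0)\<close>.
  The continuity theorem for Laplace transforms turns this into convergence in distribution, which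
  proves (i), and (iii) is the identity \<open>h(u) - h\<^sub>0 = \<integral>\<^sub>0\<^sup>u \<rho>(s) ds\<close>.

  For (iv), the Laplace transform of \<open>W'\<close> is \<open>u / \<psi>(u)\<close> (here \<open>W(0) = 0\<close> matters), and that of
  \<open>W - W(\<cdot> - r)\<close> is \<open>(1 - exp (- u r)) / \<psi>(u)\<close>.  Hence that of \<open>v\<^sub>\<infinity>\<close> is \<open>\<rho>\<close>, and
  integrating \<open>\<rho>\<close> over \<open>(0, u)\<close> yields the Levy--Khintchine formula.  Finally, (ii) follows
  from (iv): the \<open>n\<close>-th part of a Levy measure is the Levy measure of a law, which is obtained as a
  limit of compound Poisson laws.
\<close>

section \<open>Laplace transforms of laws on the half-line\<close>

lemma integrable_laplace:
  assumes "real_distribution M" "AE x in M. 0 \<le> x" "0 \<le> s"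
  shows "integrable M (\<lambda>x. exp (- s * x))"
proof -
  interpret real_distribution M by fact
  show ?thesis
  proof (rule integrable_const_bound[of _ 1])
    show "AE x in M. norm (exp (- s * x)) \<le> 1"
      using assms(2) by eventually_elim (use assms(3) in auto)
  qed simp
qed

lemma laplace_pos:
  assumes "real_distribution M" "AE x in M. 0 \<le> x" "0 \<le> s"
  shows "0 < (LINT x|M. exp (- s * x))"
proof -
  interpret real_distribution M by fact
  show ?thesis
    using integral_less_AE_space[of "\<lambda>_. 0" "\<lambda>x. exp (- s * x)"] integrable_laplace[OF assms]
      emeasure_space_1
    by simp
qed

text \<open>
  Under \<open>z = exp (- x)\<close> a law on \<open>[0, \<infinity>)\<close> becomes a law on \<open>[0, 1]\<close> whose moments are the values
  of the Laplace transform at the integers, and the step function becomes a continuous function of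
  \<open>z\<close>, which polynomials approximate uniformly by the Weierstrass theorem.
\<close>

lemma laplace_tendsto_imp_integral_cts_step:
  fixes M :: "real measure" and N :: "nat \<Rightarrow> real measure"
  assumes N: "\<And>n. real_distribution (N n)" and M: "real_distribution M"
    and N0: "\<And>n. AE x in N n. 0 \<le> x" and M0: "AE x in M. 0 \<le> x"
    and lim: "\<And>s. 0 < s \<Longrightarrow> (\<lambda>n. LINT x|N n. exp (- s * x)) \<longlonglongrightarrow> (LINT x|M. exp (- s * x))"
    and ab: "a < b"
  shows "(\<lambda>n. integral\<^sup>L (N n) (cts_step a b)) \<longlonglongrightarrow> integral\<^sup>L M (cts_step a b)"
proof -
  \<comment> \<open>The cutoff at \<open>exp (- b)\<close> avoids \<open>ln 0\<close> and is harmless, since the step vanishes beyond \<open>b\<close>.\<close>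
  define g where "g z = cts_step a b (- ln (max z (exp (- b))))" for z
  have cts: "continuous_on UNIV (cts_step a b)"
    by (rule uniformly_continuous_imp_continuous[OF cts_step_uniformly_continuous[OF ab]])
  have "continuous_on {0..1} (\<lambda>z. - ln (max z (exp (- b))))"
    by (intro continuous_intros) (auto simp: max_def)
  then have cg: "continuous_on {0..1} g"
    unfolding g_def using continuous_on_compose2[OF cts, of "{0..1}" "\<lambda>z. - ln (max z (exp (- b)))"] by auto
  have g_eq: "cts_step a b x = g (exp (- x))" for x
    using ab by (cases "x \<le> b") (auto simp: g_def max_def cts_step_def)
  have appr: "\<exists>p A d. p = (\<lambda>z. \<Sum>i\<le>d::nat. A i * z ^ i) \<and> (\<forall>z\<in>{0..1}. \<bar>g z - p z\<bar> < e)" if e: "e > 0" for e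
  proof -
    obtain p where p: "real_polynomial_function p" "\<And>z. z \<in> {0..1} \<Longrightarrow> \<bar>g z - p z\<bar> < e"
      using Stone_Weierstrass_real_polynomial_function[OF compact_Icc cg e] by metis
    obtain A d where "p = (\<lambda>z. \<Sum>i\<le>d::nat. A i * z ^ i)"
      using p(1) by (auto simp: real_polynomial_function_iff_sum)
    then show ?thesis using p(2) by blast
  qed
  have int_pow: "integrable L (\<lambda>x. exp (- x) ^ i)"
    and val_pow: "(LINT x|L. exp (- x) ^ i) = (LINT x|L. exp (- real i * x))"
    if "real_distribution L" "AE x in L. 0 \<le> x" for L and i :: nat
    using integrable_laplace[OF that, of "real i"] by (simp_all flip: exp_of_nat_mult)
  have close: "\<bar>integral\<^sup>L L (cts_step a b) - (\<Sum>i\<le>d. A i * (LINT x|L. exp (- real i * x)))\<bar> \<le> e"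
    if L: "real_distribution L" "AE x in L. 0 \<le> x" and e: "\<forall>z\<in>{0..1}. \<bar>g z - (\<Sum>i\<le>d::nat. A i * z ^ i)\<bar> < e"
    for L A d e
  proof -
    interpret real_distribution L by fact
    have i2: "integrable L (\<lambda>x. \<Sum>i\<le>d. A i * exp (- x) ^ i)"
      by (intro Bochner_Integration.integrable_sum integrable_mult_right int_pow L)
    have "(\<Sum>i\<le>d. A i * (LINT x|L. exp (- real i * x))) = (LINT x|L. (\<Sum>i\<le>d. A i * exp (- x) ^ i))"
      by (subst Bochner_Integration.integral_sum) (auto intro!: int_pow L sum.cong simp: val_pow[OF L])
    then have "integral\<^sup>L L (cts_step a b) - (\<Sum>i\<le>d. A i * (LINT x|L. exp (- real i * x)))
        = (LINT x|L. cts_step a b x - (\<Sum>i\<le>d. A i * exp (- x) ^ i))"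
      using integrable_cts_step[OF ab] i2 by simp
    also have "\<bar>\<dots>\<bar> \<le> (LINT x|L. \<bar>cts_step a b x - (\<Sum>i\<le>d. A i * exp (- x) ^ i)\<bar>)"
      using integral_abs_bound by blast
    also have "\<dots> \<le> (LINT x|L. e)"
    proof (rule integral_mono_AE)
      show "AE x in L. \<bar>cts_step a b x - (\<Sum>i\<le>d. A i * exp (- x) ^ i)\<bar> \<le> e"
        using L(2)
      proof eventually_elim
        case (elim x)
        then show ?case using e[rule_format, of "exp (-x)"] by (auto simp: g_eq intro: less_imp_le)
      qed
    qed (use integrable_cts_step[OF ab] i2 in auto)
    finally show ?thesis using prob_space by simp
  qed
  show ?thesis
  proof (rule LIMSEQ_I)
    fix e :: real assume "e > 0"
    then obtain A d where Ad: "\<forall>z\<in>{0..1}. \<bar>g z - (\<Sum>i\<le>d::nat. A i * z ^ i)\<bar> < e/3"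
      using appr[of "e/3"] by auto
    define S where "S L = (\<Sum>i\<le>d. A i * (LINT x|L. exp (- real i * x)))" for L
    have "(\<lambda>n. LINT x|N n. exp (- real i * x)) \<longlonglongrightarrow> (LINT x|M. exp (- real i * x))" for i
    proof (cases "i = 0")
      case True
      have "(LINT x|N n. 1) = (1::real)" for n
        using N[of n] by (simp add: real_distribution_def prob_space.prob_space)
      moreover have "(LINT x|M. 1) = (1::real)"
        using M by (simp add: real_distribution_def prob_space.prob_space)
      ultimately show ?thesis using True by simp
    qed (use lim in auto)
    then have "(\<lambda>n. S (N n)) \<longlonglongrightarrow> S M"
      unfolding S_def by (intro tendsto_intros)
    from LIMSEQ_D[OF this, of "e/3"] \<open>e > 0\<close> obtain n0 where
      n0: "\<And>n. n \<ge> n0 \<Longrightarrow> \<bar>S (N n) - S M\<bar> < e/3" by auto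
    have "norm (integral\<^sup>L (N n) (cts_step a b) - integral\<^sup>L M (cts_step a b)) < e" if "n \<ge> n0" for n
      using n0[OF that] close[OF N[of n] N0 Ad] close[OF M M0 Ad] unfolding S_def real_norm_def by linarith
    then show "\<exists>no. \<forall>n\<ge>no. norm (integral\<^sup>L (N n) (cts_step a b) - integral\<^sup>L M (cts_step a b)) < e"
      by blast
  qed
qed

lemma laplace_tendsto_imp_weak_conv:
  fixes M :: "real measure" and N :: "nat \<Rightarrow> real measure"
  assumes N: "\<And>n. real_distribution (N n)" and M: "real_distribution M"
    and N0: "\<And>n. AE x in N n. 0 \<le> x" and M0: "AE x in M. 0 \<le> x"
    and lim: "\<And>s. 0 < s \<Longrightarrow> (\<lambda>n. LINT x|N n. exp (- s * x)) \<longlonglongrightarrow> (LINT x|M. exp (- s * x))"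
  shows "weak_conv_m N M"
  by (rule integral_cts_step_conv_imp_weak_conv[OF N M])
    (rule laplace_tendsto_imp_integral_cts_step[OF N M N0 M0 lim])

text \<open>
  The continuity theorem applied to a constant sequence reduces this to uniqueness for characteristic
  functions.
\<close>

lemma laplace_unique:
  assumes M: "real_distribution M" "AE x in M. 0 \<le> x"
    and N: "real_distribution N" "AE x in N. 0 \<le> x"
    and eq: "\<And>s. 0 < s \<Longrightarrow> (LINT x|M. exp (- s * x)) = (LINT x|N. exp (- s * x))"
  shows "M = N"
proof -
  have w: "weak_conv_m (\<lambda>_. M) N"
    by (rule laplace_tendsto_imp_weak_conv) (use assms in auto)
  have "char M t = char N t" for t
    using levy_continuity1[OF M(1) N(1) w, of t] by (simp add: LIMSEQ_const_iff)
  then show ?thesis by (intro Levy_uniqueness M N) auto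
qed

text \<open>
  Markov's inequality for \<open>1 - exp (- s x)\<close>, which is at least \<open>1 - exp (- 1)\<close> beyond \<open>1 / s\<close>.
\<close>

lemma laplace_tail_bound:
  assumes X: "real_distribution X" "AE x in X. 0 \<le> x" and s: "0 < s"
  shows "(1 - exp (- 1)) * measure X {1 / s<..} \<le> 1 - (LINT x|X. exp (- s * x))"
proof -
  interpret real_distribution X by fact
  have "(LINT x|X. indicator {1 / s<..} x * (1 - exp (- 1))) \<le> (LINT x|X. 1 - exp (- s * x))"
  proof (rule integral_mono_AE)
    show "AE x in X. indicator {1 / s<..} x * (1 - exp (- 1)) \<le> 1 - exp (- s * x)"
      using X(2)
    proof eventually_elim
      case (elim x)
      show ?case
      proof (cases "x > 1/s")
        case True
        then have "s * x \<ge> 1" using s by (simp add: field_simps)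
        then show ?thesis using True by simp
      next
        case False
        then show ?thesis using elim s by simp
      qed
    qed
  qed (use integrable_laplace[OF X, of s] s in \<open>auto simp: less_top[symmetric]\<close>)
  then show ?thesis
    using integrable_laplace[OF X, of s] s prob_space by (simp add: mult.commute)
qed

text \<open>
  The tail bound together with the lower bound \<open>F\<close>, uniform in \<open>n\<close> and close to \<open>1\<close> near \<open>0\<close>, makes the
  sequence tight; any limit along a subsequence provided by Helly's theorem has the required Laplace
  transform.
\<close>

lemma laplace_limit_exists:
  fixes N :: "nat \<Rightarrow> real measure" and F :: "real \<Rightarrow> real"
  assumes N: "\<And>n. real_distribution (N n)" and N0: "\<And>n. AE x in N n. 0 \<le> x"
    and lim: "\<And>s. 0 < s \<Longrightarrow> (\<lambda>n. LINT x|N n. exp (- s * x)) \<longlonglongrightarrow> F s"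
    and lower: "\<And>s n. 0 < s \<Longrightarrow> F s \<le> (LINT x|N n. exp (- s * x))"
    and F0: "(F \<longlongrightarrow> 1) (at_right 0)"
  obtains M where "real_distribution M" "AE x in M. 0 \<le> x"
    "\<And>s. 0 < s \<Longrightarrow> (LINT x|M. exp (- s * x)) = F s"
proof -
  have "tight N"
    unfolding tight_def
  proof (intro conjI allI impI N)
    fix e :: real assume e: "e > 0"
    \<comment> \<open>The constant of the tail bound; \<open>s\<close> is then chosen so small that \<open>1 - F s\<close> beats \<open>c e\<close>.\<close>
    define c where "c = 1 - exp (- 1 :: real)"
    have c: "c > 0" by (simp add: c_def)
    have "eventually (\<lambda>s. F s > 1 - c * e) (at_right 0)"
      using order_tendstoD(1)[OF F0, of "1 - c * e"] c e by simp
    then have "eventually (\<lambda>s. F s > 1 - c * e \<and> s > 0) (at_right 0)"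
      using eventually_at_right_less by (rule eventually_conj)
    then obtain s where s: "F s > 1 - c * e" "s > 0"
      using eventually_happens'[of "at_right (0::real)"] by (auto simp: trivial_limit_at_right_real)
    have "measure (N n) {-1<..1 / s} > 1 - e" for n
    proof -
      interpret real_distribution "N n" by (rule N)
      have "c * measure (N n) {1 / s<..} < c * e"
        using laplace_tail_bound[OF N N0 s(2), of n] lower[OF s(2), of n] s(1) unfolding c_def by linarith
      then have tail: "measure (N n) {1 / s<..} < e" using c by simp
      have "measure (N n) {..-1} = 0"
        by (rule measure_eq_0_null_sets, rule AE_iff_null_sets[THEN iffD2])
          (use N0[of n] in \<open>auto elim!: eventually_mono\<close>)
      moreover have "1 = measure (N n) ({..-1} \<union> {-1<..1 / s} \<union> {1 / s<..})"
      proof -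
        have "{..-1} \<union> {-1<..1 / s} \<union> {1 / s<..} = (UNIV :: real set)" by auto
        then show ?thesis using prob_space by simp
      qed
      moreover have "\<dots> \<le> measure (N n) {..-1} + measure (N n) {-1<..1 / s} + measure (N n) {1 / s<..}"
        by (rule order_trans[OF measure_Un_le]) (auto intro!: measure_Un_le)
      ultimately show ?thesis using tail by linarith
    qed
    moreover have "-1 < 1 / s" using s(2) zero_less_divide_1_iff[of s] by linarith
    ultimately show "\<exists>a b. a < b \<and> (\<forall>n. 1 - e < measure (N n) {a<..b})" by blast
  qed
  from tight_imp_convergent_subsubsequence[OF this strict_mono_id] obtain r M where
    r: "strict_mono r" and M: "real_distribution M" and w: "weak_conv_m (N \<circ> r) M"
    by (auto simp: o_def)
  interpret real_distribution M by fact
  have Nr: "real_distribution ((N \<circ> r) n)" for n using N by simp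
  \<comment> \<open>The limit charges no negative numbers: test with a bounded continuous function supported there.\<close>
  have M0: "AE x in M. 0 \<le> x"
  proof -
    have "(\<lambda>n. LINT x|(N \<circ> r) n. min 1 (max 0 (- x))) \<longlonglongrightarrow> (LINT x|M. min 1 (max 0 (- x)))"
      by (rule weak_conv_imp_integral_bdd_continuous_conv[OF Nr M w, of _ 1]) (auto intro!: continuous_intros)
    moreover have "(LINT x|(N \<circ> r) n. min 1 (max 0 (- x))) = 0" for n
    proof (rule integral_eq_zero_AE)
      show "AE x in (N \<circ> r) n. min 1 (max 0 (- x)) = 0"
        using N0[of "r n"] unfolding o_def by eventually_elim auto
    qed
    ultimately have "(LINT x|M. min 1 (max 0 (- x))) = 0" by (simp add: LIMSEQ_const_iff)
    moreover have "integrable M (\<lambda>x. min 1 (max 0 (- x)))"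
      by (rule integrable_const_bound[of _ 1]) auto
    ultimately have "AE x in M. min 1 (max 0 (- x)) = 0"
      by (subst (asm) integral_nonneg_eq_0_iff_AE) auto
    then show ?thesis by eventually_elim (auto simp: min_def max_def split: if_splits)
  qed
  have "(LINT x|M. exp (- s * x)) = F s" if s: "0 < s" for s
  proof -
    have *: "(LINT x|L. exp (- s * x)) = (LINT x|L. exp (- s * max 0 x))"
      if "real_distribution L" "AE x in L. 0 \<le> x" for L
    proof -
      interpret L: real_distribution L by fact
      show ?thesis
      proof (rule integral_cong_AE)
        show "AE x in L. exp (- s * x) = exp (- s * max 0 x)"
          using that(2) by eventually_elim simp
      qed simp_all
    qed
    have "(\<lambda>n. LINT x|(N \<circ> r) n. exp (- s * max 0 x)) \<longlonglongrightarrow> (LINT x|M. exp (- s * max 0 x))"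
      by (rule weak_conv_imp_integral_bdd_continuous_conv[OF Nr M w, of _ 1])
        (use s in \<open>auto intro!: continuous_intros\<close>)
    moreover have "(\<lambda>n. LINT x|(N \<circ> r) n. exp (- s * max 0 x)) \<longlonglongrightarrow> F s"
      using LIMSEQ_subseq_LIMSEQ[OF lim[OF s] r] *[OF N N0] by (simp add: o_def)
    ultimately show ?thesis using *[OF M M0] by (metis LIMSEQ_unique)
  qed
  then show thesis using that M M0 by blast
qed

lemma laplace_iid_sum:
  assumes Q: "real_distribution Q" "AE x in Q. 0 \<le> x" and s: "0 \<le> s"
  shows "(LINT x|distr (PiM {..<n::nat} (\<lambda>_. Q)) borel (\<lambda>x. \<Sum>i<n. x i). exp (- s * x))
    = (LINT x|Q. exp (- s * x)) ^ n"
proof -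
  interpret Q: real_distribution Q by fact
  interpret product_prob_space "\<lambda>_::nat. Q" "{..<n}" ..
  have [measurable_cong]: "sets Q = sets borel" by simp
  have "(LINT x|distr (PiM {..<n::nat} (\<lambda>_. Q)) borel (\<lambda>x. \<Sum>i<n. x i). exp (- s * x))
      = (LINT x|PiM {..<n::nat} (\<lambda>_. Q). (\<Prod>i<n. exp (- s * x i)))"
    by (subst integral_distr) (auto simp: exp_sum sum_distrib_left simp flip: sum_negf)
  also have "\<dots> = (\<Prod>i<n. LINT x|Q. exp (- s * x))"
    by (rule product_integral_prod[OF finite_lessThan integrable_laplace[OF Q s]])
  finally show ?thesis by simp
qed

lemma iid_sum_law:
  assumes Q: "real_distribution Q" "AE x in Q. 0 \<le> x"
  shows "real_distribution (distr (PiM {..<n::nat} (\<lambda>_. Q)) borel (\<lambda>x. \<Sum>i<n. x i))"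
    and "AE x in distr (PiM {..<n::nat} (\<lambda>_. Q)) borel (\<lambda>x. \<Sum>i<n. x i). 0 \<le> x"
proof -
  interpret Q: real_distribution Q by fact
  interpret product_prob_space "\<lambda>_::nat. Q" "{..<n}" ..
  have [measurable_cong]: "sets Q = sets borel" by simp
  show "real_distribution (distr (PiM {..<n::nat} (\<lambda>_. Q)) borel (\<lambda>x. \<Sum>i<n. x i))"
    by (rule P.real_distribution_distr) measurable
  have "AE \<omega> in PiM {..<n} (\<lambda>_. Q). \<forall>i\<in>{..<n}. 0 \<le> \<omega> i"
    by (subst AE_finite_all) (auto intro!: AE_component Q)
  then have "AE \<omega> in PiM {..<n} (\<lambda>_. Q). 0 \<le> (\<Sum>i<n. \<omega> i)"
    by eventually_elim (auto intro: sum_nonneg)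
  then show "AE x in distr (PiM {..<n::nat} (\<lambda>_. Q)) borel (\<lambda>x. \<Sum>i<n. x i). 0 \<le> x"
    by (subst AE_distr_iff) auto
qed

text \<open>
  Markov's inequality in the other direction: \<open>exp (- s x)\<close> is at least \<open>exp (- 1)\<close> up to \<open>1 / s\<close>.
\<close>

lemma laplace_head_bound:
  assumes X: "real_distribution X" "AE x in X. 0 \<le> x" and s: "0 < s"
  shows "measure X {..1 / s} \<le> exp 1 * (LINT x|X. exp (- s * x))"
proof -
  interpret real_distribution X by fact
  have "(LINT x|X. indicator {..1 / s} x) \<le> (LINT x|X. exp 1 * exp (- s * x))"
  proof (rule integral_mono_AE)
    show "AE x in X. indicator {..1 / s} x \<le> exp 1 * exp (- s * x)"
    proof (intro always_eventually allI)
      fix x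
      have "x \<le> 1 / s \<Longrightarrow> 0 \<le> 1 - s * x" using s by (simp add: field_simps)
      then show "indicator {..1 / s} x \<le> exp 1 * exp (- s * x)"
        by (cases "x \<le> 1 / s") (auto simp flip: exp_add)
    qed
  qed (use integrable_laplace[OF X less_imp_le[OF s]] in \<open>auto simp: less_top[symmetric]\<close>)
  then show ?thesis by simp
qed

text \<open>
  Laws are given for \<open>q > 0\<close> only, hence the sequences \<open>q\<^sub>n \<rightarrow> \<infinity>\<close> are first truncated below at \<open>1\<close>.
\<close>

lemma laplace_tendsto_imp_weak_conv_at_top:
  assumes L: "\<And>q. 0 < q \<Longrightarrow> real_distribution (L q)" "\<And>q. 0 < q \<Longrightarrow> AE x in L q. 0 \<le> x"
    and M: "real_distribution M" "AE x in M. 0 \<le> x"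
    and lim: "\<And>s. 0 < s \<Longrightarrow> ((\<lambda>q. LINT x|L q. exp (- s * x)) \<longlongrightarrow> (LINT x|M. exp (- s * x))) at_top"
  shows "weak_conv_at_top L M"
  unfolding weak_conv_at_top_def
proof (intro allI impI tendsto_at_topI_sequentially)
  fix x :: real and X :: "nat \<Rightarrow> real"
  assume x: "isCont (cdf M) x" and X: "filterlim X at_top sequentially"
  define Y where "Y n = max 1 (X n)" for n
  have Y: "0 < Y n" for n by (simp add: Y_def)
  have ev: "eventually (\<lambda>n. Y n = X n) sequentially"
    using X[unfolded filterlim_at_top, rule_format, of 1] by eventually_elim (simp add: Y_def)
  then have "filterlim Y at_top sequentially"
    using X by (simp cong: filterlim_cong)
  then have "weak_conv_m (\<lambda>n. L (Y n)) M"
    by (intro laplace_tendsto_imp_weak_conv L M Y filterlim_compose[OF lim])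
  then have "(\<lambda>n. cdf (L (Y n)) x) \<longlonglongrightarrow> cdf M x"
    using x by (simp add: weak_conv_m_def weak_conv_def)
  then show "(\<lambda>n. cdf (L (X n)) x) \<longlonglongrightarrow> cdf M x"
    by (rule Lim_transform_eventually) (use ev in eventually_elim, simp)
qed

lemma positive_random_variable_law:
  assumes "positive_random_variable M X"
  shows "real_distribution (distr M borel X)" "AE x in distr M borel X. 0 \<le> x"
    "(LINT x|distr M borel X. exp (- s * x)) = (LINT \<omega>|M. exp (- s * X \<omega>))"
proof -
  interpret prob_space M using assms by (simp add: positive_random_variable_def)
  have X [measurable]: "X \<in> borel_measurable M" and pos: "AE \<omega> in M. 0 < X \<omega>"
    using assms by (auto simp: positive_random_variable_def)
  show "real_distribution (distr M borel X)" by simp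
  show "AE x in distr M borel X. 0 \<le> x"
    using pos by (subst AE_distr_iff) (auto elim!: eventually_mono)
  show "(LINT x|distr M borel X. exp (- s * x)) = (LINT \<omega>|M. exp (- s * X \<omega>))"
    by (subst integral_distr) auto
qed

section \<open>Infinite divisibility\<close>

text \<open>
  The law of a sum of a Poisson distributed number, with mean \<open>c\<close>, of independent variables of law \<open>Q\<close>:
  its Laplace transform is the Poisson generating function evaluated at the transform of \<open>Q\<close>.
\<close>

lemma compound_poisson:
  assumes Q: "real_distribution Q" "AE x in Q. 0 \<le> x" and c: "0 \<le> c"
  obtains N where "real_distribution N" "AE x in N. 0 \<le> x"
    "\<And>s. 0 < s \<Longrightarrow> (LINT x|N. exp (- s * x)) = exp (- (c * (1 - (LINT x|Q. exp (- s * x)))))"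
proof (cases "c = 0")
  case True
  show thesis
  proof (rule that)
    show "real_distribution (return borel 0)"
      by (simp add: real_distribution_def real_distribution_axioms_def prob_space_return)
    show "AE x in return borel 0. (0::real) \<le> x" by (subst AE_return) auto
  qed (simp_all add: integral_return True)
next
  case False
  then have c: "c > 0" using c by simp
  define S where "S n = distr (PiM {..<n::nat} (\<lambda>_. Q)) borel (\<lambda>x. \<Sum>i<n. x i)" for n
  have S: "real_distribution (S n)" "AE x in S n. 0 \<le> x" for n
    unfolding S_def by (intro iid_sum_law Q)+
  define N where "N = measure_pmf (poisson_pmf c) \<bind> S"
  have meas: "S \<in> measurable (measure_pmf (poisson_pmf c)) (prob_algebra borel)"
    using S(1) by (auto simp: space_prob_algebra real_distribution_def real_distribution_axioms_def)
  have meas': "S \<in> measurable (measure_pmf (poisson_pmf c)) (subprob_algebra borel)"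
    by (rule measurable_prob_algebraD[OF meas])
  have "measure_pmf (poisson_pmf c) \<in> space (prob_algebra (measure_pmf (poisson_pmf c)))"
    by (auto simp: space_prob_algebra measure_pmf.prob_space_axioms)
  from prob_space_bind'[OF this meas] sets_bind'[OF this meas]
  have N: "real_distribution N"
    by (simp add: N_def real_distribution_def real_distribution_axioms_def)
  have N0: "AE x in N. 0 \<le> x"
    unfolding N_def using S(2) by (subst AE_bind[OF meas']) auto
  show thesis
  proof (rule that[OF N N0])
    fix s :: real assume s: "0 < s"
    define f where "f = (LINT x|Q. exp (- s * x))"
    have f: "f \<ge> 0" unfolding f_def by (rule integral_nonneg_AE) simp
    have "ennreal (LINT x|N. exp (- s * x)) = (\<integral>\<^sup>+x. exp (- s * x) \<partial>N)"
      using integrable_laplace[OF N N0, of s] s by (subst nn_integral_eq_integral) auto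
    also have "\<dots> = (\<integral>\<^sup>+n. \<integral>\<^sup>+x. exp (- s * x) \<partial>S n \<partial>measure_pmf (poisson_pmf c))"
      unfolding N_def by (rule nn_integral_bind[OF _ meas']) simp
    also have "\<dots> = (\<integral>\<^sup>+n. ennreal (f ^ n) \<partial>measure_pmf (poisson_pmf c))"
    proof (intro nn_integral_cong)
      fix n
      have "(\<integral>\<^sup>+x. exp (- s * x) \<partial>S n) = ennreal (LINT x|S n. exp (- s * x))"
        using integrable_laplace[OF S, of s] s by (subst nn_integral_eq_integral) auto
      then show "(\<integral>\<^sup>+x. exp (- s * x) \<partial>S n) = ennreal (f ^ n)"
        using laplace_iid_sum[OF Q less_imp_le[OF s]] unfolding S_def f_def by simp
    qed
    also have "\<dots> = (\<Sum>n. ennreal ((c * f) ^ n / fact n * exp (- c)))"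
      using c f by (simp add: nn_integral_measure_pmf nn_integral_count_space_nat power_mult_distrib mult_ac
          flip: ennreal_mult)
    also have "\<dots> = ennreal (exp (c * f) * exp (- c))"
    proof (rule suminf_ennreal_eq)
      have "(\<lambda>n. (c * f) ^ n / fact n) sums exp (c * f)"
        using exp_converges[of "c * f"] by (simp add: field_simps)
      then show "(\<lambda>n. (c * f) ^ n / fact n * exp (- c)) sums (exp (c * f) * exp (- c))"
        by (rule sums_mult2)
    qed (use c f in auto)
    finally have "(LINT x|N. exp (- s * x)) = exp (c * f) * exp (- c)"
      by (subst (asm) ennreal_inj) (auto intro: integral_nonneg_AE)
    then show "(LINT x|N. exp (- s * x)) = exp (- (c * (1 - (LINT x|Q. exp (- s * x)))))"
      by (simp add: f_def algebra_simps flip: exp_add)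
  qed
qed

text \<open>
  A finite Levy measure of mass \<open>T\<close> is that of the compound Poisson law with intensity \<open>T\<close> and
  normalised jump law; if \<open>T = 0\<close>, there is nothing to normalise and the law is the point mass at \<open>0\<close>.
\<close>

lemma finite_levy_measure_laplace:
  assumes fin: "finite_measure L" and sets_L: "sets L = sets borel" and L0: "AE x in L. 0 \<le> x"
  obtains N where "real_distribution N" "AE x in N. 0 \<le> x"
    "\<And>s. 0 < s \<Longrightarrow> (LINT x|N. exp (- s * x)) = exp (- (LINT x|L. 1 - exp (- s * x)))"
proof -
  interpret finite_measure L by fact
  have [measurable_cong]: "sets L = sets borel" by fact
  have [simp]: "space L = UNIV" using sets_eq_imp_space_eq[OF sets_L] by simp
  define T where "T = measure L UNIV"
  have intL: "integrable L (\<lambda>x. exp (- s * x))" if "0 < s" for s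
  proof (rule integrable_const_bound[of _ 1])
    show "AE x in L. norm (exp (- s * x)) \<le> 1"
      using L0 by eventually_elim (use that in auto)
  qed simp
  show thesis
  proof (cases "T = 0")
    case True
    then have "emeasure L UNIV = 0" unfolding T_def by (simp add: emeasure_eq_measure)
    then have "AE x in L. False" by (intro AE_I[of _ _ UNIV]) auto
    then have z: "(LINT x|L. 1 - exp (- s * x)) = 0" for s
      by (intro integral_eq_zero_AE) (rule AE_mp, assumption, simp)
    show thesis
    proof (rule that)
      show "real_distribution (return borel 0)"
        by (simp add: real_distribution_def real_distribution_axioms_def prob_space_return)
      show "AE x in return borel 0. (0::real) \<le> x" by (subst AE_return) auto
      show "(LINT x|return borel 0. exp (- s * x)) = exp (- (LINT x|L. 1 - exp (- s * x)))" for s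
        unfolding z by (subst integral_return) auto
    qed
  next
    case False
    then have T: "T > 0" unfolding T_def by (simp add: measure_nonneg less_le)
    define Q where "Q = density L (\<lambda>_. ennreal (1 / T))"
    have "emeasure Q (space Q) = 1"
      using T by (simp add: Q_def emeasure_density emeasure_eq_measure T_def flip: ennreal_mult)
    then have Q: "real_distribution Q"
      by (simp add: real_distribution_def real_distribution_axioms_def prob_spaceI Q_def sets_L)
    have Q0: "AE x in Q. 0 \<le> x" unfolding Q_def using L0 by (subst AE_density) (auto elim!: eventually_mono)
    obtain N where N: "real_distribution N" "AE x in N. 0 \<le> x"
      "\<And>s. 0 < s \<Longrightarrow> (LINT x|N. exp (- s * x)) = exp (- (T * (1 - (LINT x|Q. exp (- s * x)))))"
      using compound_poisson[OF Q Q0 less_imp_le[OF T]] by blast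
    have "T * (1 - (LINT x|Q. exp (- s * x))) = (LINT x|L. 1 - exp (- s * x))" if s: "0 < s" for s
    proof -
      have "(LINT x|Q. exp (- s * x)) = (LINT x|L. exp (- s * x)) / T"
        unfolding Q_def using T by (subst integral_density) auto
      then show ?thesis
        using T intL[OF s] by (simp add: T_def field_simps)
    qed
    then show thesis using N that by auto
  qed
qed

lemma one_minus_exp_le:
  fixes s x :: real
  assumes "0 \<le> s" "0 \<le> x"
  shows "1 - exp (- s * x) \<le> max 1 s * min 1 x"
proof (cases "x \<le> 1")
  case True
  have "1 - exp (- s * x) \<le> s * x" using exp_ge_add_one_self[of "- s * x"] by simp
  also have "\<dots> \<le> max 1 s * x" using assms by (intro mult_right_mono) auto
  finally show ?thesis using True by simp
next
  case False
  have "1 - exp (- s * x) \<le> 1" by simp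
  also have "1 \<le> max 1 s" by simp
  finally show ?thesis using False by simp
qed

text \<open>
  Cutting the Levy measure off at \<open>1 / (n + 1)\<close> makes it finite.  The Laplace exponents increase to the
  full one, so the Laplace transforms stay above their limit, as \<open>laplace_limit_exists\<close> requires.
\<close>

lemma levy_measure_laplace:
  assumes sets_L: "sets L = sets borel" and int: "set_integrable L {0<..} (\<lambda>x::real. min 1 x)"
  obtains N where "real_distribution N" "AE x in N. 0 \<le> x"
    "\<And>s. 0 < s \<Longrightarrow> (LINT x|N. exp (- s * x)) = exp (- (LINT x:{0<..}|L. 1 - exp (- s * x)))"
proof -
  have [measurable_cong]: "sets L = sets borel" by fact
  have [simp]: "space L = UNIV" using sets_eq_imp_space_eq[OF sets_L] by simp
  define e where "e n = 1 / real (Suc n)" for n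
  have e: "0 < e n" "e n \<le> 1" for n by (auto simp: e_def)
  define Ln where "Ln n = density L (\<lambda>x. ennreal (indicator {e n<..} x))" for n
  define G where "G s x = indicator {0<..} x * (1 - exp (- s * x))" for s x :: real
  have G_bound: "norm (G s x) \<le> max 1 s * (indicator {0<..} x * min 1 x)" if "0 \<le> s" for s x
    using one_minus_exp_le[of s x] that by (auto simp: G_def indicator_def)
  have int': "integrable L (\<lambda>x. c * (indicator {0<..} x * min 1 x))" for c :: real
    using int by (intro integrable_mult_right) (simp add: set_integrable_def)
  have [measurable]: "G s \<in> borel_measurable borel" for s unfolding G_def by measurable
  have fin: "finite_measure (Ln n)" for n
  proof
    have "integrable L (indicator {e n<..} :: real \<Rightarrow> real)"
    proof (rule Bochner_Integration.integrable_bound[OF int'[of "1 / e n"]])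
      show "AE x in L. norm (indicator {e n<..} x :: real) \<le> norm (1 / e n * (indicator {0<..} x * min 1 x))"
        using e[of n] by (intro always_eventually) (auto simp: indicator_def min_def field_simps)
    qed simp
    then have "emeasure L {e n<..} < \<infinity>" by (subst (asm) integrable_indicator_iff) auto
    then show "emeasure (Ln n) (space (Ln n)) \<noteq> \<infinity>"
      by (simp add: Ln_def emeasure_density ennreal_indicator)
  qed
  have "\<exists>N. real_distribution N \<and> (AE x in N. 0 \<le> x) \<and>
    (\<forall>s>0. (LINT x|N. exp (- s * x)) = exp (- (LINT x|Ln n. 1 - exp (- s * x))))" for n
  proof -
    have "AE x in Ln n. 0 \<le> x"
      unfolding Ln_def using e[of n] by (subst AE_density) (auto simp: indicator_def)
    moreover have "sets (Ln n) = sets borel" by (simp add: Ln_def sets_L)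
    ultimately obtain N where "real_distribution N" "AE x in N. 0 \<le> x"
      "\<And>s. 0 < s \<Longrightarrow> (LINT x|N. exp (- s * x)) = exp (- (LINT x|Ln n. 1 - exp (- s * x)))"
      using finite_levy_measure_laplace[OF fin[of n]] by blast
    then show ?thesis by blast
  qed
  then obtain N where N: "\<And>n. real_distribution (N n)" "\<And>n. AE x in N n. 0 \<le> x"
    "\<And>n s. s > 0 \<Longrightarrow> (LINT x|N n. exp (- s * x)) = exp (- (LINT x|Ln n. 1 - exp (- s * x)))"
    by metis
  have Ln_eq: "(LINT x|Ln n. 1 - exp (- s * x)) = (LINT x|L. indicator {e n<..} x * G s x)" for n s
    unfolding Ln_def using e[of n]
    by (subst integral_density) (auto simp: G_def indicator_def intro!: Bochner_Integration.integral_cong)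
  have GI: "integrable L (G s)" if "0 \<le> s" for s
    by (rule Bochner_Integration.integrable_bound[OF int'[of "max 1 s"]])
      (use G_bound[OF that] in \<open>auto intro!: always_eventually simp: order_trans[OF _ abs_ge_self]\<close>)
  have e0: "e \<longlonglongrightarrow> 0" unfolding e_def using LIMSEQ_inverse_real_of_nat by (simp add: inverse_eq_divide)
  have lim: "(\<lambda>n. LINT x|L. indicator {e n<..} x * G s x) \<longlonglongrightarrow> integral\<^sup>L L (G s)" if s: "0 < s" for s
  proof (rule integral_dominated_convergence[OF _ _ int'[of "max 1 s"]])
    show "AE x in L. (\<lambda>n. indicator {e n<..} x * G s x) \<longlonglongrightarrow> G s x"
    proof (intro always_eventually allI)
      fix x
      show "(\<lambda>n. indicator {e n<..} x * G s x) \<longlonglongrightarrow> G s x"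
      proof (cases "x > 0")
        case True
        then have "eventually (\<lambda>n. e n < x) sequentially" using order_tendstoD(2)[OF e0] by simp
        then have "eventually (\<lambda>n. indicator {e n<..} x * G s x = G s x) sequentially"
          by eventually_elim simp
        then show ?thesis by (rule tendsto_eventually)
      qed (simp add: G_def)
    qed
    show "AE x in L. norm (indicator {e n<..} x * G s x) \<le> max 1 s * (indicator {0<..} x * min 1 x)" for n
    proof (intro always_eventually allI)
      show "norm (indicator {e n<..} x * G s x) \<le> max 1 s * (indicator {0<..} x * min 1 x)" for x
        using G_bound[of s x] s e(1)[of n] by (cases "e n < x") (auto simp: indicator_def)
    qed
  qed simp_all
  show thesis
  proof (rule laplace_limit_exists[of N "\<lambda>s. exp (- integral\<^sup>L L (G s))", OF N(1,2)])
    show "(\<lambda>n. LINT x|N n. exp (- s * x)) \<longlonglongrightarrow> exp (- integral\<^sup>L L (G s))" if "0 < s" for s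
      unfolding N(3)[OF that] Ln_eq by (intro tendsto_intros lim that)
    show "exp (- integral\<^sup>L L (G s)) \<le> (LINT x|N n. exp (- s * x))" if s: "0 < s" for s n
    proof -
      have "(LINT x|L. indicator {e n<..} x * G s x) \<le> integral\<^sup>L L (G s)"
        by (rule integral_mono_AE[OF Bochner_Integration.integrable_bound[OF GI[of s]] GI[of s]])
          (use s in \<open>auto intro!: always_eventually simp: indicator_def G_def\<close>)
      then show ?thesis unfolding N(3)[OF s] Ln_eq by simp
    qed
    have "((\<lambda>s. integral\<^sup>L L (G s)) \<longlongrightarrow> integral\<^sup>L L (G 0)) (at_right 0)"
    proof (rule tendsto_at_right_sequentially[of 0 1])
      fix S :: "nat \<Rightarrow> real" assume S: "\<And>n. 0 < S n" "\<And>n. S n < 1" "S \<longlonglongrightarrow> 0"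
      show "(\<lambda>n. integral\<^sup>L L (G (S n))) \<longlonglongrightarrow> integral\<^sup>L L (G 0)"
      proof (rule integral_dominated_convergence[OF _ _ int'[of 1]])
        show "AE x in L. (\<lambda>n. G (S n) x) \<longlonglongrightarrow> G 0 x"
          unfolding G_def using S(3) by (intro always_eventually allI tendsto_intros)
        show "AE x in L. norm (G (S n) x) \<le> 1 * (indicator {0<..} x * min 1 x)" for n
          using G_bound[of "S n"] S(1,2)[of n] by (intro always_eventually allI) (simp add: max_def)
      qed simp_all
    qed simp
    then show "((\<lambda>s. exp (- integral\<^sup>L L (G s))) \<longlongrightarrow> 1) (at_right 0)"
      by (auto simp: G_def[abs_def] intro!: tendsto_eq_intros)
  next
    fix M assume M: "real_distribution M" "AE x in M. 0 \<le> x"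
      "\<And>s. 0 < s \<Longrightarrow> (LINT x|M. exp (- s * x)) = exp (- integral\<^sup>L L (G s))"
    show thesis
      by (rule that[OF M(1,2)]) (unfold M(3), simp add: G_def[abs_def] set_lebesgue_integral_def)
  qed
qed

text \<open>
  The \<open>n\<close>-th convolution root is the law whose Levy density is the \<open>n\<close>-th part of the given one.
\<close>

lemma levy_khintchine_imp_infinitely_divisible:
  assumes \<mu>: "real_distribution \<mu>" "AE x in \<mu>. 0 \<le> x"
    and lk: "levy_khintchine (laplace_exponent \<mu>) 0 m"
  shows "infinitely_divisible \<mu>"
  unfolding infinitely_divisible_def
proof (intro allI impI)
  fix n :: nat assume n: "n \<ge> 1"
  interpret M: real_distribution \<mu> by fact
  define L where "L = density lborel (\<lambda>x. ennreal (indicator {0<..} x * (m x / real n)))"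
  define h where "h x = indicator {0<..} x * (m x / real n)" for x
  have m0: "m x \<ge> 0" if "x > 0" for x using lk that by (auto simp: levy_khintchine_def)
  have h0: "h x \<ge> 0" for x using m0 by (auto simp: h_def indicator_def)
  have "set_integrable lborel {0<..} (\<lambda>x. min 1 x * m x)" using lk by (auto simp: levy_khintchine_def)
  then have I: "integrable lborel (\<lambda>x. indicator {0<..} x * (min 1 x * m x))"
    by (simp add: set_integrable_def)
  have "(\<lambda>x. (indicator {0<..} x * (min 1 x * m x)) / (real n * min 1 x)) \<in> borel_measurable lborel"
    using borel_measurable_integrable[OF I] by measurable
  moreover have "(\<lambda>x. (indicator {0<..} x * (min 1 x * m x)) / (real n * min 1 x)) = h"
    by (auto simp: h_def fun_eq_iff indicator_def)
  ultimately have [measurable]: "h \<in> borel_measurable borel" by simp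
  have L_def': "L = density lborel h" by (simp add: L_def h_def[abs_def])
  have "set_integrable L {0<..} (\<lambda>x. min 1 x)"
  proof -
    have "integrable lborel (\<lambda>x. h x *\<^sub>R (indicator {0<..} x *\<^sub>R min 1 x))"
      by (rule Bochner_Integration.integrable_cong[THEN iffD2, OF refl _ integrable_mult_right[OF I, of "1 / real n"]])
        (auto simp: h_def indicator_def)
    then show ?thesis
      unfolding set_integrable_def L_def' using h0 by (subst integrable_density) auto
  qed
  then obtain N where N: "real_distribution N" "AE x in N. 0 \<le> x"
    "\<And>s. 0 < s \<Longrightarrow> (LINT x|N. exp (- s * x)) = exp (- (LINT x:{0<..}|L. 1 - exp (- s * x)))"
    using levy_measure_laplace[of L] by (auto simp: L_def)
  have "distr (PiM {..<n} (\<lambda>_. N)) borel (\<lambda>x. \<Sum>i<n. x i) = \<mu>"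
  proof (rule laplace_unique)
    fix s :: real assume s: "0 < s"
    have "0 < (LINT x|\<mu>. exp (- s * x))"
      using laplace_pos[OF \<mu>] s by simp
    then have "(LINT x|\<mu>. exp (- s * x)) = exp (- laplace_exponent \<mu> s)"
      by (simp add: laplace_exponent_def)
    also have "laplace_exponent \<mu> s = (LINT x:{0<..}|lborel. (1 - exp (- s * x)) * m x)"
      using lk s by (auto simp: levy_khintchine_def)
    also have "\<dots> = (LINT x|lborel. real n * (h x * (indicator {0<..} x * (1 - exp (- s * x)))))"
      unfolding set_lebesgue_integral_def using n
      by (intro Bochner_Integration.integral_cong) (auto simp: h_def indicator_def)
    also have "\<dots> = real n * (LINT x:{0<..}|L. 1 - exp (- s * x))"
      unfolding L_def' set_lebesgue_integral_def using h0 by (subst integral_density) auto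
    finally show "(LINT x|distr (PiM {..<n} (\<lambda>_. N)) borel (\<lambda>x. \<Sum>i<n. x i). exp (- s * x)) = (LINT x|\<mu>. exp (- s * x))"
      unfolding laplace_iid_sum[OF N(1,2) less_imp_le[OF s]] N(3)[OF s] by (simp flip: exp_of_nat_mult)
  qed (intro iid_sum_law N \<mu>)+
  then show "\<exists>\<nu>. real_distribution \<nu> \<and> distr (PiM {..<n} (\<lambda>_. \<nu>)) borel (\<lambda>x. \<Sum>i<n. x i) = \<mu>"
    using N(1) by blast
qed

section \<open>The branching mechanism\<close>

text \<open>
  Differentiation under the integral sign, by dominated convergence of the difference quotients, which
  the mean value theorem bounds by \<open>B\<close>.
\<close>

lemma has_real_derivative_integral:
  fixes f f' :: "real \<Rightarrow> 'a \<Rightarrow> real"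
  assumes e: "0 < e"
    and int: "\<And>x. x \<in> ball x0 e \<Longrightarrow> integrable M (f x)"
    and meas: "f' x0 \<in> borel_measurable M"
    and der: "AE r in M. \<forall>x\<in>ball x0 e. ((\<lambda>x. f x r) has_real_derivative f' x r) (at x) \<and> \<bar>f' x r\<bar> \<le> B r"
    and B: "integrable M B"
  shows "((\<lambda>x. LINT r|M. f x r) has_real_derivative (LINT r|M. f' x0 r)) (at x0)"
proof -
  let ?S = "ball x0 e"
  have x0: "x0 \<in> ?S" using e by simp
  have "((\<lambda>y. ((LINT r|M. f y r) - (LINT r|M. f x0 r)) / (y - x0)) \<longlongrightarrow> (LINT r|M. f' x0 r)) (at x0 within ?S)"
    unfolding tendsto_at_iff_sequentially
  proof (intro allI impI)
    fix X assume X: "\<forall>i. X i \<in> ?S - {x0}" "X \<longlonglongrightarrow> x0"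
    have "(\<lambda>i. LINT r|M. (f (X i) r - f x0 r) / (X i - x0)) \<longlonglongrightarrow> (LINT r|M. f' x0 r)"
    proof (rule integral_dominated_convergence[OF meas _ B])
      show "(\<lambda>r. (f (X i) r - f x0 r) / (X i - x0)) \<in> borel_measurable M" for i
        using int[OF x0] int[of "X i"] X(1) by (auto intro!: borel_measurable_divide borel_measurable_diff)
      show "AE r in M. (\<lambda>i. (f (X i) r - f x0 r) / (X i - x0)) \<longlonglongrightarrow> f' x0 r"
        using der
      proof eventually_elim
        case (elim r)
        then have "((\<lambda>y. (f y r - f x0 r) / (y - x0)) \<longlongrightarrow> f' x0 r) (at x0)"
          using x0 by (simp add: has_field_derivative_iff)
        then show ?case using X unfolding tendsto_at_iff_sequentially by (auto simp: o_def)
      qed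
      show "AE r in M. norm ((f (X i) r - f x0 r) / (X i - x0)) \<le> B r" for i
        using der
      proof eventually_elim
        case (elim r)
        have "norm (f (X i) r - f x0 r) \<le> B r * norm (X i - x0)"
          by (rule field_differentiable_bound[where S = ?S and f' = "\<lambda>x. f' x r"])
            (use elim X(1) x0 in \<open>auto intro: has_field_derivative_at_within\<close>)
        moreover have "X i - x0 \<noteq> 0" using X(1) by auto
        ultimately show ?case by (simp add: abs_divide divide_le_eq)
      qed
    qed
    moreover have "(LINT r|M. (f (X i) r - f x0 r) / (X i - x0))
        = ((LINT r|M. f (X i) r) - (LINT r|M. f x0 r)) / (X i - x0)" for i
      using int[OF x0] int[of "X i"] X(1) by simp
    ultimately show "((\<lambda>y. ((LINT r|M. f y r) - (LINT r|M. f x0 r)) / (y - x0)) \<circ> X) \<longlonglongrightarrow> (LINT r|M. f' x0 r)"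
      by (simp only: o_def)
  qed
  then show ?thesis
    using at_within_open[OF x0] by (simp add: has_field_derivative_iff)
qed

lemma exp_minus_bounds:
  fixes x :: real
  assumes "0 \<le> x"
  shows "0 \<le> exp (- x) - 1 + x" "exp (- x) - 1 + x \<le> x * (1 - exp (- x))"
    "x / (1 + x) \<le> 1 - exp (- x)" "1 - exp (- x) \<le> 2 * (x / (1 + x))"
    "1 - exp (- x) \<le> x"
proof -
  show 1: "0 \<le> exp (- x) - 1 + x" using exp_ge_add_one_self[of "-x"] by simp
  then show 6: "1 - exp (- x) \<le> x" by simp
  have 5: "1 - exp (- x) \<le> 1" by simp
  have "(1 + x) * exp (- x) \<le> exp x * exp (- x)"
    using exp_ge_add_one_self[of x] by (intro mult_right_mono) auto
  then have m: "(1 + x) * exp (- x) \<le> 1" by (simp flip: exp_add)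
  then show "exp (- x) - 1 + x \<le> x * (1 - exp (- x))" by (simp add: algebra_simps)
  from m show "x / (1 + x) \<le> 1 - exp (- x)" using assms by (simp add: field_simps)
  show "1 - exp (- x) \<le> 2 * (x / (1 + x))"
  proof (cases "x \<le> 1")
    case True
    have "x * (1 + x) \<le> x * 2" using True assms by (intro mult_left_mono) auto
    then have "x \<le> 2 * (x / (1 + x))" using assms by (simp add: field_simps)
    then show ?thesis using 6 by linarith
  next
    case False
    then have "1 \<le> 2 * (x / (1 + x))" by (simp add: field_simps)
    then show ?thesis using 5 by linarith
  qed
qed

context branching_mechanism
begin

abbreviation "\<psi> \<equiv> psi \<alpha> \<sigma> \<pi>"
abbreviation "\<Phi> \<equiv> phi \<alpha> \<sigma> \<pi>"

lemma sets_pi' [measurable_cong]: "sets \<pi> = sets borel"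
  by (rule sets_pi)

lemma space_pi [simp]: "space \<pi> = UNIV"
  using sets_eq_imp_space_eq[OF sets_pi] by simp

lemma sigma_finite_pi: "sigma_finite_measure \<pi>"
proof
  let ?A = "insert {..0} (range (\<lambda>n. {1 / real (Suc n)..real n}))"
  have "x \<in> \<Union> ?A" for x :: real
  proof (cases "x > 0")
    case True
    obtain n m where "inverse (real (Suc n)) < x" "x < real m"
      using reals_Archimedean[OF True] reals_Archimedean2[of x] by auto
    moreover have "1 / real (Suc (max n m)) \<le> inverse (real (Suc n))"
      by (simp add: field_simps)
    ultimately have "x \<in> {1 / real (Suc (max n m))..real (max n m)}" by auto
    then show ?thesis by blast
  qed auto
  then have "\<Union> ?A = space \<pi>" unfolding space_pi by blast
  moreover have "emeasure \<pi> {1 / real (Suc n)..real n} \<noteq> \<infinity>" for n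
  proof -
    have "{1 / real (Suc n)..real n} \<subseteq> {0<..}"
      by (auto intro: less_le_trans[of 0 "1 / real (Suc n)"])
    then show ?thesis using pi_radon[of "{1 / real (Suc n)..real n}"] by auto
  qed
  ultimately show "\<exists>A. countable A \<and> A \<subseteq> sets \<pi> \<and> \<Union> A = space \<pi> \<and> (\<forall>a\<in>A. emeasure \<pi> a \<noteq> \<infinity>)"
    using pi_nonpos by (intro exI[of _ ?A] conjI) (auto simp: sets_pi simp del: Union_iff)
qed

lemma pi_dominated:
  assumes "f \<in> borel_measurable borel" "\<And>r. 0 < r \<Longrightarrow> \<bar>f r\<bar> \<le> c * min r (r\<^sup>2)"
  shows "set_integrable \<pi> {0<..} f"
  unfolding set_integrable_def
proof (rule Bochner_Integration.integrable_bound)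
  show "integrable \<pi> (\<lambda>r. c * (indicator {0<..} r *\<^sub>R min r (r\<^sup>2)))"
    using pi_integrable unfolding set_integrable_def by (rule integrable_mult_right)
  show "AE r in \<pi>. norm (indicator {0<..} r *\<^sub>R f r) \<le> norm (c * (indicator {0<..} r *\<^sub>R min r (r\<^sup>2)))"
    using assms(2) by (intro always_eventually allI) (auto simp: indicator_def intro: order_trans[OF _ abs_ge_self])
qed (use assms(1) in measurable)

text \<open>
  Together with the next bound, this is what makes the integrals over \<open>\<pi>\<close> in \<open>\<psi>\<close> and its derivative
  finite: the Levy measure integrates \<open>min r (r\<^sup>2)\<close>.
\<close>

lemma psi_kernel_bound:
  fixes u r :: real
  assumes ur: "0 \<le> u" "0 < r"
  shows "\<bar>exp (- u * r) - 1 + u * r\<bar> \<le> max u (u\<^sup>2) * min r (r\<^sup>2)"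
proof -
  have x: "0 \<le> u * r" using ur by simp
  have "exp (- (u * r)) - 1 + u * r \<le> u * r" using x by simp
  also have "\<dots> \<le> max u (u\<^sup>2) * r" using ur by (intro mult_right_mono) auto
  finally have 1: "exp (- (u * r)) - 1 + u * r \<le> max u (u\<^sup>2) * r" .
  have "exp (- (u * r)) - 1 + u * r \<le> (u * r) * (u * r)"
    by (rule order_trans[OF exp_minus_bounds(2)[OF x]], rule mult_left_mono) (use x exp_minus_bounds(5)[OF x] in auto)
  also have "\<dots> = u\<^sup>2 * r\<^sup>2" by (simp add: power2_eq_square)
  also have "\<dots> \<le> max u (u\<^sup>2) * r\<^sup>2" by (intro mult_right_mono) auto
  finally show ?thesis using 1 exp_minus_bounds(1)[OF x] by (auto simp: min_def)
qed

lemma dpsi_kernel_bound: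
  fixes u r :: real
  assumes ur: "0 \<le> u" "0 < r"
  shows "\<bar>r * (1 - exp (- u * r))\<bar> \<le> max 1 u * min r (r\<^sup>2)"
proof -
  have x: "0 \<le> u * r" using ur by simp
  have "r * (1 - exp (- (u * r))) \<le> r * 1" using ur by (intro mult_left_mono) auto
  also have "\<dots> \<le> max 1 u * r" using ur mult_right_mono[of 1 "max 1 u" r] by simp
  finally have 1: "r * (1 - exp (- (u * r))) \<le> max 1 u * r" .
  have "r * (1 - exp (- (u * r))) \<le> r * (u * r)"
    using exp_minus_bounds(5)[OF x] ur by (intro mult_left_mono) auto
  also have "\<dots> = u * r\<^sup>2" by (simp add: power2_eq_square)
  also have "\<dots> \<le> max 1 u * r\<^sup>2" by (intro mult_right_mono) auto
  finally show ?thesis using 1 ur x by (auto simp: min_def abs_mult)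
qed

lemma psi_kernel_integrable: "0 \<le> u \<Longrightarrow> set_integrable \<pi> {0<..} (\<lambda>r. exp (- u * r) - 1 + u * r)"
  by (rule pi_dominated[OF _ psi_kernel_bound]) auto

lemma dpsi_kernel_integrable: "0 \<le> u \<Longrightarrow> set_integrable \<pi> {0<..} (\<lambda>r. r * (1 - exp (- u * r)))"
  by (rule pi_dominated[OF _ dpsi_kernel_bound]) auto

definition dpsi :: "real \<Rightarrow> real" where
  "dpsi u = \<alpha> + \<sigma>\<^sup>2 * u + (LINT r:{0<..}|\<pi>. r * (1 - exp (- u * r)))"

lemma psi_deriv:
  assumes u: "0 < u"
  shows "(\<psi> has_real_derivative dpsi u) (at u)"
proof -
  define B where "B r = max 1 (2 * u) * (indicator {0<..} r *\<^sub>R min r (r\<^sup>2))" for r :: real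
  have B: "integrable \<pi> B"
    unfolding B_def using pi_integrable unfolding set_integrable_def by (rule integrable_mult_right)
  have "((\<lambda>u. LINT r|\<pi>. indicator {0<..} r *\<^sub>R (exp (- u * r) - 1 + u * r)) has_real_derivative
      (LINT r|\<pi>. indicator {0<..} r *\<^sub>R (r * (1 - exp (- u * r))))) (at u)"
  proof (rule has_real_derivative_integral[OF u _ _ _ B])
    show "integrable \<pi> (\<lambda>r. indicator {0<..} r *\<^sub>R (exp (- x * r) - 1 + x * r))" if "x \<in> ball u u" for x
    proof -
      have "0 \<le> x" using that unfolding mem_ball dist_real_def by linarith
      then show ?thesis using psi_kernel_integrable[of x] by (simp add: set_integrable_def)
    qed
    show "AE r in \<pi>. \<forall>x\<in>ball u u.
        ((\<lambda>x. indicator {0<..} r *\<^sub>R (exp (- x * r) - 1 + x * r)) has_real_derivative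
           indicator {0<..} r *\<^sub>R (r * (1 - exp (- x * r)))) (at x) \<and>
        \<bar>indicator {0<..} r *\<^sub>R (r * (1 - exp (- x * r)))\<bar> \<le> B r"
    proof (intro always_eventually allI ballI conjI)
      fix r x :: real assume "x \<in> ball u u"
      then have x: "0 < x" "x < 2 * u" by (auto simp: dist_real_def)
      show "((\<lambda>x. indicator {0<..} r *\<^sub>R (exp (- x * r) - 1 + x * r)) has_real_derivative
           indicator {0<..} r *\<^sub>R (r * (1 - exp (- x * r)))) (at x)"
        by (auto intro!: derivative_eq_intros simp: algebra_simps)
      have "0 < r \<Longrightarrow> \<bar>r * (1 - exp (- x * r))\<bar> \<le> max 1 (2 * u) * min r (r\<^sup>2)"
        using x by (intro order_trans[OF dpsi_kernel_bound] mult_right_mono) auto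
      then show "\<bar>indicator {0<..} r *\<^sub>R (r * (1 - exp (- x * r)))\<bar> \<le> B r"
        by (auto simp: B_def indicator_def)
    qed
  qed measurable
  then show ?thesis
    unfolding psi_def[abs_def] dpsi_def set_lebesgue_integral_def
    by (auto intro!: derivative_eq_intros)
qed

text \<open>
  Continuity is obtained by differentiating once more under the integral; away from \<open>u = 0\<close> the factor
  \<open>exp (- u r)\<close> dominates the additional \<open>r\<close>.
\<close>

lemma dpsi_cont:
  assumes u: "0 < u"
  shows "isCont dpsi u"
proof -
  define B where "B r = max 1 (2 / u) * (indicator {0<..} r *\<^sub>R min r (r\<^sup>2))" for r :: real
  have B: "integrable \<pi> B"
    unfolding B_def using pi_integrable unfolding set_integrable_def by (rule integrable_mult_right)
  have u2: "0 < u / 2" using u by simp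
  have "((\<lambda>u. LINT r|\<pi>. indicator {0<..} r *\<^sub>R (r * (1 - exp (- u * r)))) has_real_derivative
      (LINT r|\<pi>. indicator {0<..} r *\<^sub>R (r\<^sup>2 * exp (- u * r)))) (at u)"
  proof (rule has_real_derivative_integral[OF u2 _ _ _ B])
    show "integrable \<pi> (\<lambda>r. indicator {0<..} r *\<^sub>R (r * (1 - exp (- x * r))))" if "x \<in> ball u (u/2)" for x
    proof -
      have "0 \<le> x" using that unfolding mem_ball dist_real_def by linarith
      then show ?thesis using dpsi_kernel_integrable[of x] by (simp add: set_integrable_def)
    qed
    show "AE r in \<pi>. \<forall>x\<in>ball u (u / 2).
        ((\<lambda>x. indicator {0<..} r *\<^sub>R (r * (1 - exp (- x * r)))) has_real_derivative
           indicator {0<..} r *\<^sub>R (r\<^sup>2 * exp (- x * r))) (at x) \<and>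
        \<bar>indicator {0<..} r *\<^sub>R (r\<^sup>2 * exp (- x * r))\<bar> \<le> B r"
    proof (intro always_eventually allI ballI conjI)
      fix r x :: real assume "x \<in> ball u (u / 2)"
      then have x: "u / 2 < x" unfolding mem_ball dist_real_def by linarith
      show "((\<lambda>x. indicator {0<..} r *\<^sub>R (r * (1 - exp (- x * r)))) has_real_derivative
           indicator {0<..} r *\<^sub>R (r\<^sup>2 * exp (- x * r))) (at x)"
        by (auto intro!: derivative_eq_intros simp: algebra_simps power2_eq_square)
      have "r\<^sup>2 * exp (- x * r) \<le> max 1 (2 / u) * min r (r\<^sup>2)" if r: "0 < r"
      proof -
        have "r\<^sup>2 * exp (- x * r) \<le> r\<^sup>2 * 1" using r x u by (intro mult_left_mono) auto
        also have "\<dots> \<le> max 1 (2 / u) * r\<^sup>2" using mult_right_mono[of 1 "max 1 (2/u)" "r\<^sup>2"] by simp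
        finally have 1: "r\<^sup>2 * exp (- x * r) \<le> max 1 (2 / u) * r\<^sup>2" .
        have "u / 2 * r \<le> x * r" using r x by (intro mult_right_mono) auto
        also have "\<dots> \<le> exp (x * r)" using exp_ge_add_one_self[of "x * r"] by linarith
        finally have "r * exp (- x * r) \<le> 2 / u" using u by (simp add: exp_minus field_simps)
        then have "r * (r * exp (- x * r)) \<le> r * max 1 (2 / u)" using r by (intro mult_left_mono) auto
        then show ?thesis using 1 by (auto simp: min_def power2_eq_square mult_ac)
      qed
      then show "\<bar>indicator {0<..} r *\<^sub>R (r\<^sup>2 * exp (- x * r))\<bar> \<le> B r"
        by (auto simp: B_def indicator_def)
    qed
  qed measurable
  then have "isCont (\<lambda>u. LINT r|\<pi>. indicator {0<..} r *\<^sub>R (r * (1 - exp (- u * r)))) u"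
    by (rule DERIV_isCont)
  then show ?thesis
    unfolding dpsi_def[abs_def] set_lebesgue_integral_def by (intro continuous_intros)
qed

lemma set_integral_pi_nonneg:
  fixes f :: "real \<Rightarrow> real"
  assumes "\<And>r. 0 < r \<Longrightarrow> 0 \<le> f r"
  shows "0 \<le> (LINT r:{0<..}|\<pi>. f r)"
  unfolding set_lebesgue_integral_def
proof (rule integral_nonneg_AE, rule always_eventually, rule allI)
  show "0 \<le> indicator {0<..} r *\<^sub>R f r" for r
    using assms[of r] by (auto simp: indicator_def)
qed

lemma dpsi_ge:
  assumes u: "0 \<le> u"
  shows "\<alpha> \<le> dpsi u"
proof -
  have "0 \<le> (LINT r:{0<..}|\<pi>. r * (1 - exp (- u * r)))"
    using u by (intro set_integral_pi_nonneg mult_nonneg_nonneg) auto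
  then show ?thesis using u by (simp add: dpsi_def)
qed

lemma dpsi_mono: "0 \<le> u \<Longrightarrow> u \<le> v \<Longrightarrow> dpsi u \<le> dpsi v"
  unfolding dpsi_def
  by (intro add_mono mult_left_mono set_integral_mono dpsi_kernel_integrable)
    (auto intro!: mult_left_mono mult_right_mono)

lemma psi_kernel_integral_nonneg:
  assumes u: "0 \<le> u"
  shows "0 \<le> (LINT r:{0<..}|\<pi>. exp (- u * r) - 1 + u * r)"
proof (rule set_integral_pi_nonneg)
  show "0 \<le> exp (- u * r) - 1 + u * r" if "0 < r" for r
    using exp_minus_bounds(1)[of "u * r"] u that by simp
qed

lemma psi_ge: "0 \<le> u \<Longrightarrow> \<alpha> * u \<le> \<psi> u"
  using psi_kernel_integral_nonneg[of u] by (simp add: psi_def)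

text \<open>
  This is convexity of \<open>\<psi>\<close> at \<open>0\<close>, read off termwise from \<open>exp (- x) - 1 + x \<le> x (1 - exp (- x))\<close>.
\<close>

lemma psi_le:
  assumes u: "0 \<le> u"
  shows "\<psi> u \<le> u * dpsi u"
proof -
  have "(LINT r:{0<..}|\<pi>. exp (- u * r) - 1 + u * r) \<le> (LINT r:{0<..}|\<pi>. u * (r * (1 - exp (- u * r))))"
  proof (intro set_integral_mono psi_kernel_integrable set_integrable_mult_right dpsi_kernel_integrable u)
    show "exp (- u * r) - 1 + u * r \<le> u * (r * (1 - exp (- u * r)))" if "r \<in> {0<..}" for r
      using exp_minus_bounds(2)[of "u * r"] u that by (simp add: mult.assoc)
  qed
  also have "\<dots> = u * (LINT r:{0<..}|\<pi>. r * (1 - exp (- u * r)))" by simp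
  finally have *: "(LINT r:{0<..}|\<pi>. exp (- u * r) - 1 + u * r) \<le> u * (LINT r:{0<..}|\<pi>. r * (1 - exp (- u * r)))" .
  have "\<alpha> * u + 1 / 2 * \<sigma>\<^sup>2 * u\<^sup>2 + A \<le> u * (\<alpha> + \<sigma>\<^sup>2 * u + B)" if "A \<le> u * B" for A B
  proof -
    have "1 / 2 * \<sigma>\<^sup>2 * u\<^sup>2 \<le> \<sigma>\<^sup>2 * u\<^sup>2" by simp
    then show ?thesis using that by (simp add: algebra_simps power2_eq_square)
  qed
  from this[OF *] show ?thesis unfolding psi_def dpsi_def .
qed

text \<open>
  All three terms of \<open>\<psi>\<close> are nonnegative.  If they vanish at one \<open>u > 0\<close>, then \<open>\<alpha> = \<sigma> = 0\<close> and
  \<open>\<pi> = 0\<close>, so that \<open>\<psi>\<close> vanishes identically and cannot tend to infinity.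
\<close>

lemma psi_pos:
  assumes u: "0 < u"
  shows "0 < \<psi> u"
proof (rule ccontr)
  assume "\<not> 0 < \<psi> u"
  then have le: "\<psi> u \<le> 0" by simp
  have I: "0 \<le> (LINT r:{0<..}|\<pi>. exp (- u * r) - 1 + u * r)"
    using u by (intro psi_kernel_integral_nonneg) simp
  have t: "0 \<le> \<alpha> * u" "0 \<le> 1 / 2 * \<sigma>\<^sup>2 * u\<^sup>2" using alpha_nonneg u by auto
  with I le have z: "\<alpha> * u = 0" "1 / 2 * \<sigma>\<^sup>2 * u\<^sup>2 = 0" "(LINT r:{0<..}|\<pi>. exp (- u * r) - 1 + u * r) = 0"
    unfolding psi_def by linarith+
  define f where "f r = indicator {0<..} r *\<^sub>R (exp (- u * r) - 1 + u * r)" for r :: real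
  have f0: "0 \<le> f r" for r
    using exp_minus_bounds(1)[of "u * r"] u by (auto simp: f_def indicator_def)
  have "integrable \<pi> f" "integral\<^sup>L \<pi> f = 0"
    using z(3) psi_kernel_integrable[of u] u
    by (simp_all add: set_lebesgue_integral_def set_integrable_def f_def[abs_def])
  then have "AE r in \<pi>. f r = 0"
    using f0 by (subst (asm) integral_nonneg_eq_0_iff_AE) auto
  then have AE0: "AE r in \<pi>. r \<le> 0"
  proof eventually_elim
    case (elim r)
    show ?case
    proof (rule ccontr)
      assume r: "\<not> r \<le> 0"
      then have "1 - u * r < exp (- (u * r))" using u exp_minus_greater[of "u * r"] by simp
      then show False using elim r by (simp add: f_def)
    qed
  qed
  have "\<psi> v = 0" for v
  proof -
    have "(LINT r:{0<..}|\<pi>. exp (- v * r) - 1 + v * r) = 0"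
      unfolding set_lebesgue_integral_def
    proof (rule integral_eq_zero_AE)
      show "AE r in \<pi>. indicator {0<..} r *\<^sub>R (exp (- v * r) - 1 + v * r) = 0"
        using AE0 by eventually_elim simp
    qed
    then show ?thesis using z u by (simp add: psi_def)
  qed
  then have "\<psi> = (\<lambda>_. 0)" by auto
  moreover have "eventually (\<lambda>v. \<psi> v > 0) at_top"
    using psi_at_top by (auto simp: filterlim_at_top_dense)
  ultimately show False by simp
qed

lemma inverse_psi_cont: "continuous_on {0<..} (\<lambda>u. 1 / \<psi> u)"
proof (intro continuous_at_imp_continuous_on ballI)
  fix u :: real assume "u \<in> {0<..}"
  then show "isCont (\<lambda>u. 1 / \<psi> u) u"
    using psi_pos[of u] DERIV_isCont[OF psi_deriv[of u]] by (intro continuous_intros) auto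
qed

lemma inverse_psi_integrable_atLeast:
  assumes s: "0 < s"
  shows "set_integrable lborel {s..} (\<lambda>u. 1 / \<psi> u)"
proof -
  obtain c where c: "c > 1" "set_integrable lborel {c..} (\<lambda>u. 1 / \<psi> u)"
    using inverse_psi_integrable by (auto simp: integrable_at_infinity_def)
  have "set_integrable lborel {s..max s c} (\<lambda>u. 1 / \<psi> u)"
    by (rule borel_integrable_atLeastAtMost'[OF continuous_on_subset[OF inverse_psi_cont]]) (use s in auto)
  from set_integrable_Un[OF this c(2)]
  have "set_integrable lborel ({s..max s c} \<union> {c..}) (\<lambda>u. 1 / \<psi> u)" by simp
  then show ?thesis by (rule set_integrable_subset) auto
qed

lemma phi_deriv:
  assumes s: "0 < s"
  shows "(\<Phi> has_real_derivative - (1 / \<psi> s)) (at s)"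
proof -
  define a b where "a = s / 2" and "b = 2 * s"
  have ab: "0 < a" "a < s" "s < b" using s by (auto simp: a_def b_def)
  have eq: "\<Phi> x = \<Phi> a - (LBINT u=a..x. 1 / \<psi> u)" if "x \<in> {a..b}" for x
  proof -
    have "(LINT u:{a..<x} \<union> {x..}|lborel. 1 / \<psi> u) =
        (LINT u:{a..<x}|lborel. 1 / \<psi> u) + (LINT u:{x..}|lborel. 1 / \<psi> u)"
      by (rule set_integral_Un) (use that in \<open>auto intro!: set_integrable_subset[OF inverse_psi_integrable_atLeast[OF ab(1)]]\<close>)
    moreover have "{a..<x} \<union> {x..} = {a..}" using that by auto
    ultimately show ?thesis using that by (simp add: phi_def interval_integral_Ico)
  qed
  have "((\<lambda>x. LBINT u=a..x. 1 / \<psi> u) has_vector_derivative 1 / \<psi> s) (at s within {a..b})"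
    by (rule interval_integral_FTC2[where a=a and b=b])
      (use ab in \<open>auto intro!: continuous_on_subset[OF inverse_psi_cont]\<close>)
  then have "((\<lambda>x. LBINT u=a..x. 1 / \<psi> u) has_real_derivative 1 / \<psi> s) (at s)"
    using at_within_Icc_at[OF ab(2,3)] by (simp add: has_real_derivative_iff_has_vector_derivative)
  then have "((\<lambda>x. \<Phi> a - (LBINT u=a..x. 1 / \<psi> u)) has_real_derivative - (1 / \<psi> s)) (at s)"
    by (auto intro!: derivative_eq_intros)
  then show ?thesis
  proof (rule has_field_derivative_transform_within_open[where S = "{a<..<b}"])
    show "\<Phi> a - (LBINT u=a..x. 1 / \<psi> u) = \<Phi> x" if "x \<in> {a<..<b}" for x
      by (rule eq[symmetric]) (use that in auto)
  qed (use ab in auto)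
qed

lemma phi_strict_antimono:
  assumes "0 < s" "s < t"
  shows "\<Phi> t < \<Phi> s"
proof (rule DERIV_neg_imp_decreasing[OF assms(2)])
  fix x assume "s \<le> x"
  then show "\<exists>y. (\<Phi> has_real_derivative y) (at x) \<and> y < 0"
    using assms phi_deriv[of x] psi_pos[of x] by (intro exI[of _ "- (1 / \<psi> x)"]) auto
qed

lemma phi_inj: "inj_on \<Phi> {0<..}"
proof (rule inj_onI)
  fix x y assume "x \<in> {0<..}" "y \<in> {0<..}" "\<Phi> x = \<Phi> y"
  then show "x = y"
    using phi_strict_antimono[of x y] phi_strict_antimono[of y x] by (cases x y rule: linorder_cases) auto
qed

text \<open>
  Near \<open>0\<close>, \<open>1 / \<psi>\<close> is at least a multiple of \<open>1 / u\<close>, so \<open>\<phi>\<close> grows there at least logarithmically.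
  This makes every \<open>q \<ge> \<phi>(1)\<close> a value of \<open>\<phi>\<close>.
\<close>

lemma phi_ge_log:
  assumes s: "0 < s" "s \<le> 1"
  shows "\<Phi> 1 \<le> \<Phi> s + ln s / dpsi 1"
proof -
  have K: "0 < dpsi 1" using psi_pos[of 1] psi_le[of 1] by simp
  have "\<Phi> 1 + ln 1 / dpsi 1 \<le> \<Phi> s + ln s / dpsi 1"
  proof (rule DERIV_nonpos_imp_nonincreasing[OF s(2)])
    fix x assume x: "s \<le> x" "x \<le> 1"
    have "\<psi> x \<le> x * dpsi 1"
      using psi_le[of x] dpsi_mono[of x 1] x s by (meson mult_left_mono order_trans less_le_trans less_imp_le)
    then have "1 / (x * dpsi 1) \<le> 1 / \<psi> x" using psi_pos[of x] x s by (intro divide_left_mono) (auto intro!: mult_pos_pos K)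
    moreover have "((\<lambda>s. \<Phi> s + ln s / dpsi 1) has_real_derivative - (1 / \<psi> x) + 1 / (x * dpsi 1)) (at x)"
      using x s K by (auto intro!: derivative_eq_intros phi_deriv simp: field_simps)
    ultimately show "\<exists>y. ((\<lambda>s. \<Phi> s + ln s / dpsi 1) has_real_derivative y) (at x) \<and> y \<le> 0" by fastforce
  qed
  then show ?thesis by simp
qed

lemma varphi_props:
  assumes q: "\<Phi> 1 \<le> q"
  shows "0 < varphi \<alpha> \<sigma> \<pi> q" "\<Phi> (varphi \<alpha> \<sigma> \<pi> q) = q"
proof -
  have K: "0 < dpsi 1" using psi_pos[of 1] psi_le[of 1] by simp
  \<comment> \<open>The point at which the logarithmic lower bound for \<open>\<phi>\<close> reaches \<open>q\<close>.\<close>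
  define s where "s = exp (- dpsi 1 * (q - \<Phi> 1))"
  have s: "0 < s" "s \<le> 1" using q K by (auto simp: s_def)
  have "q \<le> \<Phi> s" using phi_ge_log[OF s] K by (simp add: s_def)
  moreover have "continuous_on {s..1} \<Phi>"
    by (rule continuous_at_imp_continuous_on) (use s in \<open>auto intro!: DERIV_isCont[OF phi_deriv]\<close>)
  ultimately obtain x where "s \<le> x" "x \<le> 1" "\<Phi> x = q"
    using IVT2'[of \<Phi> 1 q s] q s by auto
  then have "q \<in> \<Phi> ` {0<..}" using s by (intro image_eqI[of _ _ x]) auto
  then show "0 < varphi \<alpha> \<sigma> \<pi> q" "\<Phi> (varphi \<alpha> \<sigma> \<pi> q) = q"
    using the_inv_into_into[OF phi_inj, of q "{0<..}"] f_the_inv_into_f[OF phi_inj, of q]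
    by (auto simp: varphi_def)
qed

lemma varphi_tendsto: "filterlim (varphi \<alpha> \<sigma> \<pi>) (at_right 0) at_top"
  unfolding filterlim_at
proof
  show "eventually (\<lambda>q. varphi \<alpha> \<sigma> \<pi> q \<in> {0<..} \<and> varphi \<alpha> \<sigma> \<pi> q \<noteq> 0) at_top"
    using varphi_props(1) by (auto simp: eventually_at_top_linorder less_imp_neq[symmetric] intro!: exI[of _ "\<Phi> 1"])
  show "(varphi \<alpha> \<sigma> \<pi> \<longlongrightarrow> 0) at_top"
  proof (rule order_tendstoI)
    fix e :: real assume "e > 0"
    have "varphi \<alpha> \<sigma> \<pi> q < e" if "q \<ge> max (\<Phi> 1) (\<Phi> e + 1)" for q
    proof (rule ccontr)
      assume "\<not> varphi \<alpha> \<sigma> \<pi> q < e"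
      then have "\<Phi> (varphi \<alpha> \<sigma> \<pi> q) \<le> \<Phi> e"
        using phi_strict_antimono[OF \<open>e > 0\<close>, of "varphi \<alpha> \<sigma> \<pi> q"] by (cases "varphi \<alpha> \<sigma> \<pi> q = e") auto
      then show False using varphi_props(2)[of q] that by auto
    qed
    then show "eventually (\<lambda>q. varphi \<alpha> \<sigma> \<pi> q < e) at_top"
      unfolding eventually_at_top_linorder by blast
  next
    fix e :: real assume "e < 0"
    then show "eventually (\<lambda>q. e < varphi \<alpha> \<sigma> \<pi> q) at_top"
      using varphi_props(1) by (auto simp: eventually_at_top_linorder intro: less_trans[of e 0])
  qed
qed

end

section \<open>The logarithmic moment condition\<close>

context branching_mechanism
begin

definition exponent_rate :: "real \<Rightarrow> real" where "exponent_rate u = (dpsi u - \<alpha>) / \<psi> u"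

text \<open>
  A primitive of \<open>exponent_rate\<close>: the logarithm contributes \<open>\<psi>' / \<psi>\<close> and \<open>\<alpha> \<phi>\<close> contributes \<open>- \<alpha> / \<psi>\<close>.
\<close>

definition exponent_potential :: "real \<Rightarrow> real" where "exponent_potential u = ln (\<psi> u) + \<alpha> * \<Phi> u"

lemma dpsi_measurable [measurable]: "dpsi \<in> borel_measurable borel"
proof -
  interpret sigma_finite_measure \<pi> by (rule sigma_finite_pi)
  show ?thesis unfolding dpsi_def[abs_def] set_lebesgue_integral_def by measurable
qed

lemma psi_measurable [measurable]: "\<psi> \<in> borel_measurable borel"
proof -
  interpret sigma_finite_measure \<pi> by (rule sigma_finite_pi)
  show ?thesis unfolding psi_def[abs_def] set_lebesgue_integral_def by measurable
qed

lemma exponent_rate_measurable [measurable]: "exponent_rate \<in> borel_measurable borel"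
  unfolding exponent_rate_def[abs_def] by measurable

lemma exponent_rate_nonneg: "0 < u \<Longrightarrow> 0 \<le> exponent_rate u"
  using dpsi_ge[of u] psi_pos[of u] by (simp add: exponent_rate_def)

lemma exponent_rate_cont: "0 < u \<Longrightarrow> isCont exponent_rate u"
  unfolding exponent_rate_def[abs_def] using psi_pos[of u] DERIV_isCont[OF psi_deriv[of u]] dpsi_cont[of u]
  by (intro continuous_intros) auto

lemma exponent_potential_deriv:
  assumes "0 < u"
  shows "(exponent_potential has_real_derivative exponent_rate u) (at u)"
  unfolding exponent_potential_def[abs_def] exponent_rate_def
  using psi_pos[OF assms] by (auto intro!: derivative_eq_intros psi_deriv phi_deriv assms simp: diff_divide_distrib)

lemma exponent_potential_mono: "0 < u \<Longrightarrow> u \<le> v \<Longrightarrow> exponent_potential u \<le> exponent_potential v"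
  by (rule DERIV_nonneg_imp_nondecreasing[of u v exponent_potential]) (use exponent_potential_deriv exponent_rate_nonneg in \<open>meson less_le_trans\<close>)+

text \<open>
  A nondecreasing function that is bounded below has a limit at \<open>0\<close>, and the fundamental theorem of
  calculus for the nonnegative integrand \<open>exponent_rate\<close> includes its integrability.
\<close>

lemma exponent_potential_limit:
  assumes B: "\<And>u. 0 < u \<Longrightarrow> B \<le> exponent_potential u"
  obtains H0 where "(exponent_potential \<longlongrightarrow> H0) (at_right 0)"
    "\<And>u. 0 < u \<Longrightarrow> set_integrable lborel {0<..<u} exponent_rate"
    "\<And>u. 0 < u \<Longrightarrow> (LINT s:{0<..<u}|lborel. exponent_rate s) = exponent_potential u - H0"
proof -
  have "\<exists>H0. (exponent_potential \<longlongrightarrow> H0) (at_right 0)"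
    using Lim_right_bound[of UNIV 0 exponent_potential B] exponent_potential_mono B by auto
  then obtain H0 where H0: "(exponent_potential \<longlongrightarrow> H0) (at_right 0)" ..
  have "set_integrable lborel {0<..<u} exponent_rate \<and> (LINT s:{0<..<u}|lborel. exponent_rate s) = exponent_potential u - H0" if u: "0 < u" for u
  proof -
    have lim_u: "(exponent_potential \<longlongrightarrow> exponent_potential u) (at_left u)"
      using DERIV_isCont[OF exponent_potential_deriv[OF u]] by (simp add: isCont_def filterlim_at_split)
    note FTC = interval_integral_FTC_nonneg[of "ereal 0" "ereal u" exponent_potential exponent_rate H0 "exponent_potential u"]
    have lims: "((exponent_potential \<circ> real_of_ereal) \<longlongrightarrow> H0) (at_right (ereal 0))" "((exponent_potential \<circ> real_of_ereal) \<longlongrightarrow> exponent_potential u) (at_left (ereal u))"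
      unfolding ereal_tendsto_simps using H0 lim_u .
    have "set_integrable lborel (einterval (ereal 0) (ereal u)) exponent_rate" "(LBINT x=ereal 0..ereal u. exponent_rate x) = exponent_potential u - H0"
      by (rule FTC[OF _ _ _ _ lims]; use u exponent_potential_deriv exponent_rate_cont exponent_rate_nonneg in \<open>auto intro!: always_eventually\<close>)+
    then show ?thesis using u by (simp add: interval_lebesgue_integral_le_eq)
  qed
  then show thesis using that H0 by blast
qed

text \<open>
  The alternative to a finite limit at \<open>0\<close>; monotonicity leaves no third case.
\<close>

lemma exponent_potential_at_bot:
  assumes "\<not> (\<exists>B. \<forall>u>0. B \<le> exponent_potential u)"
  shows "filterlim exponent_potential at_bot (at_right 0)"
  unfolding filterlim_at_bot
proof
  fix B
  obtain u where u: "0 < u" "exponent_potential u < B" using assms by (meson not_le)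
  have "eventually (\<lambda>x. x \<in> {0<..<u}) (at_right 0)" using eventually_at_right_real[OF u(1)] .
  then show "eventually (\<lambda>x. exponent_potential x \<le> B) (at_right 0)"
    by eventually_elim (use exponent_potential_mono u in \<open>auto intro: order_trans[of _ "exponent_potential u"]\<close>)
qed

lemma exponent_rate_nn_integral:
  assumes a: "0 < a" "a \<le> 1"
  shows "(\<integral>\<^sup>+u. ennreal (exponent_rate u) * indicator {a..1} u \<partial>lborel) = ennreal (exponent_potential 1 - exponent_potential a)"
  by (rule nn_integral_FTC_Icc) (use a exponent_potential_deriv exponent_rate_nonneg in auto)

text \<open>
  \<open>exponent_rate\<close> is the derivative of \<open>exponent_potential\<close>, so its integral over \<open>(a, 1)\<close> is the increment.
\<close>

lemma exponent_potential_bounded_iff: "(\<exists>B. \<forall>u>0. B \<le> exponent_potential u) \<longleftrightarrow> (\<integral>\<^sup>+u. ennreal (exponent_rate u) * indicator {0<..<1} u \<partial>lborel) < \<infinity>"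
  (is "?l \<longleftrightarrow> ?N < \<infinity>")
proof
  assume ?l
  then obtain B where B: "\<And>u. 0 < u \<Longrightarrow> B \<le> exponent_potential u" by blast
  obtain H0 where "\<And>u. 0 < u \<Longrightarrow> set_integrable lborel {0<..<u} exponent_rate"
    using exponent_potential_limit[OF B] by metis
  then have "integrable lborel (\<lambda>u. indicator {0<..<1} u *\<^sub>R exponent_rate u)" by (simp add: set_integrable_def)
  then have "(\<integral>\<^sup>+u. ennreal (norm (indicator {0<..<1} u *\<^sub>R exponent_rate u)) \<partial>lborel) < \<infinity>"
    by (simp add: integrable_iff_bounded)
  moreover have "(\<integral>\<^sup>+u. ennreal (norm (indicator {0<..<1} u *\<^sub>R exponent_rate u)) \<partial>lborel) = ?N"
    by (intro nn_integral_cong) (auto simp: indicator_def exponent_rate_nonneg)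
  ultimately show "?N < \<infinity>" by simp
next
  assume N: "?N < \<infinity>"
  then obtain n where n: "?N = ennreal n" "0 \<le> n" by (cases ?N) auto
  have "exponent_potential 1 - n \<le> exponent_potential a" if a: "0 < a" for a
  proof (cases "a \<le> 1")
    case True
    have "ennreal (exponent_potential 1 - exponent_potential a) = (\<integral>\<^sup>+u. ennreal (exponent_rate u) * indicator {a..1} u \<partial>lborel)"
      using exponent_rate_nn_integral[OF a True] by simp
    also have "\<dots> \<le> ?N"
    proof (rule nn_integral_mono_AE)
      show "AE u in lborel. ennreal (exponent_rate u) * indicator {a..1} u \<le> ennreal (exponent_rate u) * indicator {0<..<1} u"
        using AE_lborel_singleton[of 1] by eventually_elim (use a in \<open>auto simp: indicator_def\<close>)
    qed
    finally show ?thesis using n by (simp add: ennreal_le_iff)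
  next
    case False
    then show ?thesis using exponent_potential_mono[of 1 a] n by simp
  qed
  then show ?l by blast
qed

lemma dpsi_nn_integral:
  assumes u: "0 < u"
  shows "ennreal ((dpsi u - \<alpha>) / u)
    = ennreal (\<sigma>\<^sup>2) + (\<integral>\<^sup>+r. ennreal (indicator {0<..} r * (r * (1 - exp (- u * r)) / u)) \<partial>\<pi>)"
proof -
  have i: "integrable \<pi> (\<lambda>r. indicator {0<..} r * (r * (1 - exp (- u * r)) / u))"
    using integrable_mult_left[OF dpsi_kernel_integrable[of u, unfolded set_integrable_def], of "1 / u"] u
    by (simp add: mult.assoc)
  have nonneg: "0 \<le> indicator {0<..} r * (r * (1 - exp (- u * r)) / u)" for r
    using u by (auto simp: indicator_def intro!: mult_nonneg_nonneg divide_nonneg_pos)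
  have "(dpsi u - \<alpha>) / u = \<sigma>\<^sup>2 + (LINT r|\<pi>. indicator {0<..} r * (r * (1 - exp (- u * r)) / u))"
    using u unfolding dpsi_def set_lebesgue_integral_def by (simp add: field_simps)
  also have "ennreal \<dots> = ennreal (\<sigma>\<^sup>2) + ennreal (LINT r|\<pi>. indicator {0<..} r * (r * (1 - exp (- u * r)) / u))"
    by (rule ennreal_plus[OF _ integral_nonneg_AE[OF always_eventually]]) (use nonneg in auto)
  also have "ennreal (LINT r|\<pi>. indicator {0<..} r * (r * (1 - exp (- u * r)) / u))
     = (\<integral>\<^sup>+r. ennreal (indicator {0<..} r * (r * (1 - exp (- u * r)) / u)) \<partial>\<pi>)"
    by (rule nn_integral_eq_integral[OF i, symmetric]) (use nonneg in auto)
  finally show ?thesis .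
qed

end

lemma nn_integral_ln_kernel:
  fixes r :: real
  assumes r: "0 < r"
  shows "(\<integral>\<^sup>+u. ennreal (indicator {0<..<1} u * (r / (1 + u * r))) \<partial>lborel) = ennreal (ln (1 + r))"
proof -
  have "(\<integral>\<^sup>+u. ennreal (indicator {0<..<1} u * (r / (1 + u * r))) \<partial>lborel)
      = (\<integral>\<^sup>+u. ennreal (r / (1 + u * r)) * indicator {0..1} u \<partial>lborel)"
  proof (rule nn_integral_cong_AE)
    show "AE u in lborel. ennreal (indicator {0<..<1} u * (r / (1 + u * r))) = ennreal (r / (1 + u * r)) * indicator {0..1} u"
      using AE_lborel_singleton[of 0] AE_lborel_singleton[of 1]
      by eventually_elim (auto simp: indicator_def)
  qed
  also have "\<dots> = ennreal (ln (1 + 1 * r) - ln (1 + 0 * r))"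
  proof (rule nn_integral_FTC_Icc)
    fix x :: real assume x: "x \<in> {0..1}"
    then have p: "0 < 1 + x * r" using r by (auto intro!: add_pos_nonneg)
    show "((\<lambda>x. ln (1 + x * r)) has_real_derivative r / (1 + x * r)) (at x)"
      using p by (auto intro!: derivative_eq_intros)
    show "0 \<le> r / (1 + x * r)" using p r by simp
  qed auto
  finally show ?thesis by simp
qed

text \<open>
  The kernel \<open>(1 - exp (- u r)) / u\<close> lies between \<open>r / (1 + u r)\<close> and twice this function, whose
  integral over \<open>(0, 1)\<close> is \<open>ln (1 + r)\<close>.
\<close>

lemma nn_integral_exp_kernel_bounds:
  fixes r :: real
  assumes r: "0 < r"
  defines "j \<equiv> (\<integral>\<^sup>+u. ennreal (indicator {0<..<1} u * ((1 - exp (- u * r)) / u)) \<partial>lborel)"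
  shows "ennreal (ln (1 + r)) \<le> j" "j \<le> 2 * ennreal (ln (1 + r))"
proof -
  have *: "r / (1 + u * r) \<le> (1 - exp (- u * r)) / u" "(1 - exp (- u * r)) / u \<le> 2 * (r / (1 + u * r))"
    if u: "0 < u" for u
  proof -
    have p: "0 < 1 + u * r" using u r by (simp add: add_pos_pos)
    have "u * (r / (1 + u * r)) \<le> 1 - exp (- u * r)"
      using exp_minus_bounds(3)[of "u * r"] u r by simp
    then show "r / (1 + u * r) \<le> (1 - exp (- u * r)) / u"
      using u by (simp add: le_divide_eq mult.commute)
    have "1 - exp (- u * r) \<le> u * (2 * (r / (1 + u * r)))"
      using exp_minus_bounds(4)[of "u * r"] u r by (simp add: mult.left_commute)
    then show "(1 - exp (- u * r)) / u \<le> 2 * (r / (1 + u * r))"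
      using u by (simp add: divide_le_eq mult.commute)
  qed
  show "ennreal (ln (1 + r)) \<le> j"
    unfolding j_def nn_integral_ln_kernel[OF r, symmetric]
    by (intro nn_integral_mono ennreal_leI) (use * in \<open>auto simp: indicator_def\<close>)
  have "j \<le> (\<integral>\<^sup>+u. 2 * ennreal (indicator {0<..<1} u * (r / (1 + u * r))) \<partial>lborel)"
    unfolding j_def
  proof (intro nn_integral_mono)
    fix u :: real
    show "ennreal (indicator {0<..<1} u * ((1 - exp (- u * r)) / u)) \<le> 2 * ennreal (indicator {0<..<1} u * (r / (1 + u * r)))"
    proof (cases "0 < u \<and> u < 1")
      case True
      then have "ennreal ((1 - exp (- u * r)) / u) \<le> ennreal (2 * (r / (1 + u * r)))"
        by (intro ennreal_leI *) simp
      also have "\<dots> = 2 * ennreal (r / (1 + u * r))" by (subst ennreal_mult') auto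
      finally show ?thesis using True by simp
    qed (auto simp: indicator_def)
  qed
  also have "\<dots> = 2 * ennreal (ln (1 + r))"
    unfolding nn_integral_ln_kernel[OF r, symmetric] by (rule nn_integral_cmult) measurable
  finally show "j \<le> 2 * ennreal (ln (1 + r))" .
qed

context branching_mechanism
begin

text \<open>
  By Tonelli's theorem the integral on the left is \<open>\<sigma>\<^sup>2 + \<integral> r j(r) \<pi>(dr)\<close> with \<open>j\<close> comparable to
  \<open>ln (1 + r)\<close>.
\<close>

lemma dpsi_nn_integral_finite_iff:
  "(\<integral>\<^sup>+u. ennreal (indicator {0<..<1} u * ((dpsi u - \<alpha>) / u)) \<partial>lborel) < \<infinity> \<longleftrightarrow>
   (\<integral>\<^sup>+r. ennreal (indicator {0<..} r * (r * ln (1 + r))) \<partial>\<pi>) < \<infinity>" (is "?X < \<infinity> \<longleftrightarrow> ?L < \<infinity>")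
proof -
  interpret pi: sigma_finite_measure \<pi> by (rule sigma_finite_pi)
  interpret P: pair_sigma_finite lborel \<pi> ..
  define j where "j r = (\<integral>\<^sup>+u. ennreal (indicator {0<..<1} u * ((1 - exp (- u * r)) / u)) \<partial>lborel)" for r :: real
  define k where "k u r = ennreal (indicator {0<..} r * r) * ennreal (indicator {0<..<1} u * ((1 - exp (- u * r)) / u))"
    for u r :: real
  have k_meas: "case_prod k \<in> borel_measurable (lborel \<Otimes>\<^sub>M \<pi>)"
    unfolding k_def[abs_def] case_prod_beta by measurable
  have "?X = (\<integral>\<^sup>+u. ennreal (\<sigma>\<^sup>2) * indicator {0<..<1} u + (\<integral>\<^sup>+r. k u r \<partial>\<pi>) \<partial>lborel)"
  proof (intro nn_integral_cong)
    fix u :: real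
    show "ennreal (indicator {0<..<1} u * ((dpsi u - \<alpha>) / u))
        = ennreal (\<sigma>\<^sup>2) * indicator {0<..<1} u + (\<integral>\<^sup>+r. k u r \<partial>\<pi>)"
    proof (cases "0 < u \<and> u < 1")
      case True
      then have "ennreal (indicator {0<..} r * (r * (1 - exp (- u * r)) / u)) = k u r" for r
        by (auto simp: k_def indicator_def simp flip: ennreal_mult)
      then show ?thesis using True dpsi_nn_integral[of u] by simp
    qed (auto simp: indicator_def k_def)
  qed
  also have "\<dots> = (\<integral>\<^sup>+u. ennreal (\<sigma>\<^sup>2) * indicator {0<..<1::real} u \<partial>lborel) + (\<integral>\<^sup>+u. \<integral>\<^sup>+r. k u r \<partial>\<pi> \<partial>lborel)"
    by (rule nn_integral_add) (use pi.borel_measurable_nn_integral[OF k_meas] in auto)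
  also have "(\<integral>\<^sup>+u. ennreal (\<sigma>\<^sup>2) * indicator {0<..<1::real} u \<partial>lborel) = ennreal (\<sigma>\<^sup>2)"
    by (simp add: nn_integral_cmult_indicator)
  also have "(\<integral>\<^sup>+u. \<integral>\<^sup>+r. k u r \<partial>\<pi> \<partial>lborel) = (\<integral>\<^sup>+r. \<integral>\<^sup>+u. k u r \<partial>lborel \<partial>\<pi>)"
    by (rule P.Fubini'[OF k_meas, symmetric])
  also have "\<dots> = (\<integral>\<^sup>+r. ennreal (indicator {0<..} r * r) * j r \<partial>\<pi>)"
    unfolding k_def j_def by (intro nn_integral_cong nn_integral_cmult) measurable
  finally have X: "?X = ennreal (\<sigma>\<^sup>2) + (\<integral>\<^sup>+r. ennreal (indicator {0<..} r * r) * j r \<partial>\<pi>)" .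
  have "?L \<le> (\<integral>\<^sup>+r. ennreal (indicator {0<..} r * r) * j r \<partial>\<pi>)"
  proof (rule nn_integral_mono)
    fix r :: real
    show "ennreal (indicator {0<..} r * (r * ln (1 + r))) \<le> ennreal (indicator {0<..} r * r) * j r"
      using nn_integral_exp_kernel_bounds(1)[of r]
      by (cases "0 < r") (auto simp: ennreal_mult j_def intro!: mult_left_mono)
  qed
  moreover have "(\<integral>\<^sup>+r. ennreal (indicator {0<..} r * r) * j r \<partial>\<pi>) \<le> 2 * ?L"
  proof -
    have "(\<integral>\<^sup>+r. ennreal (indicator {0<..} r * r) * j r \<partial>\<pi>)
        \<le> (\<integral>\<^sup>+r. 2 * ennreal (indicator {0<..} r * (r * ln (1 + r))) \<partial>\<pi>)"
    proof (rule nn_integral_mono)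
      fix r :: real
      show "ennreal (indicator {0<..} r * r) * j r \<le> 2 * ennreal (indicator {0<..} r * (r * ln (1 + r)))"
      proof (cases "0 < r")
        case True
        have "ennreal r * j r \<le> ennreal r * (2 * ennreal (ln (1 + r)))"
          unfolding j_def by (intro mult_left_mono nn_integral_exp_kernel_bounds True) auto
        also have "\<dots> = 2 * ennreal (r * ln (1 + r))" using True by (simp add: ennreal_mult mult.left_commute)
        finally show ?thesis using True by simp
      qed simp
    qed
    also have "\<dots> = 2 * ?L" by (rule nn_integral_cmult) measurable
    finally show ?thesis .
  qed
  ultimately show ?thesis unfolding X
    by (auto simp: less_top[symmetric] top_unique ennreal_mult_eq_top_iff)
qed

text \<open>
  For \<open>\<alpha> > 0\<close>, \<open>\<psi>(u)\<close> lies between \<open>\<alpha> u\<close> and \<open>\<psi>'(1) u\<close> on \<open>(0, 1)\<close>.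
\<close>

lemma exponent_rate_nn_integral_finite_iff:
  assumes a: "0 < \<alpha>"
  shows "(\<integral>\<^sup>+u. ennreal (exponent_rate u) * indicator {0<..<1} u \<partial>lborel) < \<infinity> \<longleftrightarrow>
    (\<integral>\<^sup>+u. ennreal (indicator {0<..<1} u * ((dpsi u - \<alpha>) / u)) \<partial>lborel) < \<infinity>" (is "?N < \<infinity> \<longleftrightarrow> ?X < \<infinity>")
proof -
  have K: "0 < dpsi 1" using psi_pos[of 1] psi_le[of 1] by simp
  have 1: "?N \<le> (\<integral>\<^sup>+u. ennreal (1 / \<alpha>) * ennreal (indicator {0<..<1} u * ((dpsi u - \<alpha>) / u)) \<partial>lborel)"
  proof (rule nn_integral_mono)
    fix u :: real
    show "ennreal (exponent_rate u) * indicator {0<..<1} u \<le> ennreal (1 / \<alpha>) * ennreal (indicator {0<..<1} u * ((dpsi u - \<alpha>) / u))"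
    proof (cases "0 < u \<and> u < 1")
      case True
      have "exponent_rate u \<le> (dpsi u - \<alpha>) / (\<alpha> * u)"
        unfolding exponent_rate_def using True a dpsi_ge[of u] psi_ge[of u] psi_pos[of u] by (intro divide_left_mono) auto
      also have "\<dots> = 1 / \<alpha> * ((dpsi u - \<alpha>) / u)" using True a by (simp add: field_simps)
      finally show ?thesis using True a dpsi_ge[of u] by (auto intro!: ennreal_leI simp flip: ennreal_mult)
    qed (auto simp: indicator_def)
  qed
  have 2: "?X \<le> (\<integral>\<^sup>+u. ennreal (dpsi 1) * (ennreal (exponent_rate u) * indicator {0<..<1} u) \<partial>lborel)"
  proof (rule nn_integral_mono)
    fix u :: real
    show "ennreal (indicator {0<..<1} u * ((dpsi u - \<alpha>) / u)) \<le> ennreal (dpsi 1) * (ennreal (exponent_rate u) * indicator {0<..<1} u)"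
    proof (cases "0 < u \<and> u < 1")
      case True
      have "\<psi> u \<le> u * dpsi 1"
        using psi_le[of u] dpsi_mono[of u 1] True mult_left_mono[of "dpsi u" "dpsi 1" u] by linarith
      then have "1 / u \<le> dpsi 1 / \<psi> u" using True psi_pos[of u] K by (simp add: field_simps)
      then have "(dpsi u - \<alpha>) * (1 / u) \<le> (dpsi u - \<alpha>) * (dpsi 1 / \<psi> u)"
        using dpsi_ge[of u] True by (intro mult_left_mono) auto
      also have "\<dots> = dpsi 1 * exponent_rate u" by (simp add: exponent_rate_def)
      finally show ?thesis using True K exponent_rate_nonneg[of u] by (auto intro!: ennreal_leI simp flip: ennreal_mult)
    qed (auto simp: indicator_def)
  qed
  have "?N \<le> ennreal (1 / \<alpha>) * ?X" using 1 by (subst (asm) nn_integral_cmult) auto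
  moreover have "?X \<le> ennreal (dpsi 1) * ?N" using 2 by (subst (asm) nn_integral_cmult) auto
  ultimately show ?thesis
    by (auto simp: less_top[symmetric] top_unique ennreal_mult_eq_top_iff)
qed

text \<open>
  Near \<open>0\<close>, \<open>r ln (1 + r)\<close> is at most \<open>r\<^sup>2\<close>, and at infinity it differs from \<open>r ln r\<close> by at most
  \<open>r\<close>; both corrections are integrable with respect to \<open>\<pi>\<close>.
\<close>

lemma r_ln_integrable_iff:
  "(\<integral>\<^sup>+r. ennreal (indicator {0<..} r * (r * ln (1 + r))) \<partial>\<pi>) < \<infinity> \<longleftrightarrow> integrable_at_infinity \<pi> (\<lambda>r. r * ln r)"
  (is "?L < \<infinity> \<longleftrightarrow> _")
proof
  assume L: "?L < \<infinity>"
  have "integrable \<pi> (\<lambda>r. indicator {2..} r *\<^sub>R (r * ln r))"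
  proof (rule integrableI_nonneg)
    show "AE r in \<pi>. 0 \<le> indicator {2..} r *\<^sub>R (r * ln r)"
      by (intro always_eventually) (auto simp: indicator_def)
    have "(\<integral>\<^sup>+r. ennreal (indicator {2..} r *\<^sub>R (r * ln r)) \<partial>\<pi>) \<le> ?L"
    proof (intro nn_integral_mono ennreal_leI)
      fix r :: real
      show "indicator {2..} r *\<^sub>R (r * ln r) \<le> indicator {0<..} r * (r * ln (1 + r))"
        by (auto simp: indicator_def intro!: mult_left_mono)
    qed
    then show "(\<integral>\<^sup>+r. ennreal (indicator {2..} r *\<^sub>R (r * ln r)) \<partial>\<pi>) < \<infinity>" using L by (rule le_less_trans)
  qed measurable
  then show "integrable_at_infinity \<pi> (\<lambda>r. r * ln r)"
    unfolding integrable_at_infinity_def set_integrable_def by (intro exI[of _ 2]) auto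
next
  assume "integrable_at_infinity \<pi> (\<lambda>r. r * ln r)"
  then obtain c where c: "c > 1" "integrable \<pi> (\<lambda>r. indicator {c..} r *\<^sub>R (r * ln r))"
    by (auto simp: integrable_at_infinity_def set_integrable_def)
  \<comment> \<open>The constant covers \<open>r \<le> c\<close>; beyond \<open>c\<close>, \<open>ln (1 + r) \<le> 1 + ln r\<close>.\<close>
  define C where "C = 1 + ln (1 + c)"
  have C: "1 \<le> C" "ln (1 + c) \<le> C" using c by (auto simp: C_def)
  have bound: "r * ln (1 + r) \<le> C * min r (r\<^sup>2) + indicator {c..} r *\<^sub>R (r * ln r)" if r: "0 < r" for r
  proof -
    have l: "0 \<le> ln (1 + r)" using r by simp
    consider "r \<le> 1" | "1 < r" "r < c" | "c \<le> r" by linarith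
    then show ?thesis
    proof cases
      case 1
      have "r * ln (1 + r) \<le> r * r" using ln_add_one_self_le_self[of r] r by (intro mult_left_mono) auto
      also have "\<dots> \<le> C * (r * r)" using C r mult_right_mono[of 1 C "r * r"] by simp
      also have "r * r = min r (r\<^sup>2)" using 1 r mult_left_mono[of r 1 r] by (simp add: power2_eq_square)
      finally show ?thesis using c 1 by simp
    next
      case 2
      have m: "min r (r\<^sup>2) = r" using 2 mult_left_mono[of 1 r r] by (simp add: power2_eq_square)
      have "r * ln (1 + r) \<le> r * C" using 2 C order_trans[of "ln (1+r)" "ln (1 + c)" C] by (intro mult_left_mono) auto
      then show ?thesis using 2 by (simp add: m mult.commute)
    next
      case 3
      have "ln (1 + r) \<le> ln (2 * r)" using 3 c by simp
      also have "\<dots> = ln 2 + ln r" using 3 c by (simp add: ln_mult)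
      also have "ln 2 \<le> (1::real)" using ln_le_minus_one[of 2] by simp
      finally have "r * ln (1 + r) \<le> r * (1 + ln r)" using r by (intro mult_left_mono) auto
      also have "\<dots> \<le> C * r + r * ln r" using C r mult_right_mono[of 1 C r] by (simp add: algebra_simps)
      finally show ?thesis using 3 c mult_left_mono[of 1 r r] by (simp add: power2_eq_square)
    qed
  qed
  have "integrable \<pi> (\<lambda>r. indicator {0<..} r * (r * ln (1 + r)))"
  proof (rule Bochner_Integration.integrable_bound)
    show "integrable \<pi> (\<lambda>r. C * (indicator {0<..} r *\<^sub>R min r (r\<^sup>2)) + indicator {c..} r *\<^sub>R (r * ln r))"
      using pi_integrable c unfolding set_integrable_def
      by (intro Bochner_Integration.integrable_add integrable_mult_right) auto
    show "AE r in \<pi>. norm (indicator {0<..} r * (r * ln (1 + r)))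
       \<le> norm (C * (indicator {0<..} r *\<^sub>R min r (r\<^sup>2)) + indicator {c..} r *\<^sub>R (r * ln r))"
    proof (intro always_eventually allI)
      fix r
      show "norm (indicator {0<..} r * (r * ln (1 + r)))
       \<le> norm (C * (indicator {0<..} r *\<^sub>R min r (r\<^sup>2)) + indicator {c..} r *\<^sub>R (r * ln r))"
      proof (cases "0 < r")
        case True
        then show ?thesis using order_trans[OF bound[OF True] abs_ge_self] by (simp add: abs_mult)
      qed simp
    qed
  qed measurable
  then have "(\<integral>\<^sup>+r. ennreal (norm (indicator {0<..} r * (r * ln (1 + r)))) \<partial>\<pi>) < \<infinity>"
    by (simp add: integrable_iff_bounded)
  moreover have "(\<integral>\<^sup>+r. ennreal (norm (indicator {0<..} r * (r * ln (1 + r)))) \<partial>\<pi>) = ?L"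
    by (intro nn_integral_cong) (auto simp: indicator_def abs_mult)
  ultimately show "?L < \<infinity>" by simp
qed

text \<open>
  If \<open>\<alpha> = 0\<close>, then \<open>exponent_potential\<close> is \<open>ln \<psi>\<close>, which is unbounded below because \<open>\<psi>\<close> is at most
  linear near \<open>0\<close>.  Otherwise the preceding equivalences combine.
\<close>

lemma log_condition_iff: "log_condition \<alpha> \<pi> \<longleftrightarrow> (\<exists>B. \<forall>u>0. B \<le> exponent_potential u)"
proof (cases "\<alpha> = 0")
  case True
  have K: "0 < dpsi 1" using psi_pos[of 1] psi_le[of 1] by simp
  have "\<exists>u>0. exponent_potential u < B" for B
  proof -
    \<comment> \<open>Small enough that the linear bound for \<open>\<psi>\<close> falls below \<open>exp (B - 1)\<close>.\<close>
    define u where "u = min 1 (exp (B - 1) / dpsi 1)"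
    have u: "0 < u" "u \<le> 1" "u * dpsi 1 \<le> exp (B - 1)" using K by (auto simp: u_def min_def field_simps)
    have "\<psi> u \<le> u * dpsi u" using psi_le[of u] u by simp
    also have "\<dots> \<le> u * dpsi 1" using dpsi_mono[of u 1] u by (intro mult_left_mono) auto
    also note u(3)
    finally have "ln (\<psi> u) \<le> ln (exp (B - 1))" using psi_pos[OF u(1)] by (subst ln_le_cancel_iff) auto
    then have "exponent_potential u < B" unfolding exponent_potential_def using True by simp
    then show ?thesis using u by blast
  qed
  then show ?thesis using True by (auto simp: log_condition_def not_le)
next
  case False
  then have "0 < \<alpha>" using alpha_nonneg by simp
  then show ?thesis
    by (simp only: exponent_potential_bounded_iff exponent_rate_nn_integral_finite_iff dpsi_nn_integral_finite_iff r_ln_integrable_iff log_condition_def simp_thms)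
qed

end

section \<open>The Levy density and the scale function\<close>

lemma nn_integral_exp_greaterThan:
  fixes u y :: real
  assumes u: "0 < u"
  shows "(\<integral>\<^sup>+x. ennreal (exp (- u * x)) * indicator {y<..} x \<partial>lborel) = ennreal (exp (- u * y) / u)"
proof -
  have "(\<integral>\<^sup>+x. ennreal (exp (- u * x)) * indicator {y<..} x \<partial>lborel)
      = (\<integral>\<^sup>+x. ennreal (exp (- u * x)) * indicator {y..} x \<partial>lborel)"
    by (rule nn_integral_cong_AE, rule AE_mp[OF AE_lborel_singleton[of y]]) (auto simp: indicator_def)
  also have "\<dots> = ennreal (0 - (- (exp (- u * y) / u)))"
  proof (rule nn_integral_FTC_atLeast)
    show "((\<lambda>x. - (exp (- u * x) / u)) has_real_derivative exp (- u * x)) (at x)" for x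
      using u by (auto intro!: derivative_eq_intros)
    have "((\<lambda>x. - (exp (- (u * x)) / u)) \<longlongrightarrow> - (0 / u)) at_top"
      by (intro tendsto_intros filterlim_compose[OF exp_at_bot] filterlim_compose[OF filterlim_uminus_at_bot_at_top]
          filterlim_tendsto_pos_mult_at_top[OF tendsto_const u] filterlim_ident) (use u in auto)
    then show "((\<lambda>x. - (exp (- u * x) / u)) \<longlongrightarrow> 0) at_top" by simp
  qed auto
  finally show ?thesis by simp
qed

lemma nn_integral_exp_initial:
  fixes u x :: real
  assumes u: "0 < u" and x: "0 < x"
  shows "(\<integral>\<^sup>+s. ennreal (exp (- s * x)) * indicator {0<..<u} s \<partial>lborel) = ennreal ((1 - exp (- u * x)) / x)"
proof -
  have "(\<integral>\<^sup>+s. ennreal (exp (- s * x)) * indicator {0<..<u} s \<partial>lborel)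
      = (\<integral>\<^sup>+s. ennreal (exp (- s * x)) * indicator {0..u} s \<partial>lborel)"
    by (rule nn_integral_cong_AE, rule AE_mp[OF AE_lborel_singleton[of 0]], rule AE_mp[OF AE_lborel_singleton[of u]])
      (auto simp: indicator_def)
  also have "\<dots> = ennreal (- (exp (- u * x) / x) - - (exp (- 0 * x) / x))"
    by (rule nn_integral_FTC_Icc) (use u x in \<open>auto intro!: derivative_eq_intros\<close>)
  finally show ?thesis by (simp add: diff_divide_distrib)
qed

locale differentiable_scale_function = branching_mechanism +
  fixes W W' :: "real \<Rightarrow> real"
  assumes scale: "scale_function (psi \<alpha> \<sigma> \<pi>) W"
    and W_deriv: "\<And>x. x > 0 \<Longrightarrow> (W has_real_derivative W' x) (at x)"
    and W_deriv_cont: "continuous_on {0<..} W'"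
begin

lemma W_neg: "x < 0 \<Longrightarrow> W x = 0"
  using scale by (auto simp: scale_function_def)

lemma W_nonneg: "0 \<le> W x"
  using scale by (cases "x < 0") (auto simp: scale_function_def)

lemma W_mono: "mono W"
proof (rule monoI)
  fix x y :: real assume "x \<le> y"
  then show "W x \<le> W y"
    using scale W_nonneg[of y] W_neg[of x]
    by (cases "x < 0"; cases "x = y") (auto simp: scale_function_def strict_mono_on_def less_imp_le)
qed

lemma W_measurable [measurable]: "W \<in> borel_measurable borel"
  using W_mono by (rule borel_measurable_mono)

lemma W_integrable:
  assumes "0 < u"
  shows "integrable lborel (\<lambda>x. exp (- u * x) * W x)" "(LINT x|lborel. exp (- u * x) * W x) = 1 / \<psi> u"
proof -
  have eq: "(\<lambda>x. indicator {0..} x *\<^sub>R (exp (- u * x) * W x)) = (\<lambda>x. exp (- u * x) * W x)"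
    by (auto simp: indicator_def W_neg fun_eq_iff)
  have "set_integrable lborel {0..} (\<lambda>x. exp (- u * x) * W x)" "(LINT x:{0..}|lborel. exp (- u * x) * W x) = 1 / \<psi> u"
    using scale assms by (auto simp: scale_function_def)
  then show "integrable lborel (\<lambda>x. exp (- u * x) * W x)" "(LINT x|lborel. exp (- u * x) * W x) = 1 / \<psi> u"
    unfolding set_integrable_def set_lebesgue_integral_def eq by auto
qed

lemma W_laplace:
  assumes "0 < u"
  shows "(\<integral>\<^sup>+x. ennreal (exp (- u * x) * W x) \<partial>lborel) = ennreal (1 / \<psi> u)"
  using nn_integral_eq_integral[OF W_integrable(1)[OF assms]] W_integrable(2)[OF assms] W_nonneg by simp

text \<open>
  Since \<open>W \<ge> W(0)\<close>, the Laplace transform gives \<open>W(0) / u \<le> 1 / \<psi>(u)\<close>.  If \<open>W(0)\<close> were positive, then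
  \<open>1 / \<psi>\<close> would not be integrable at infinity; quantitatively, \<open>\<phi>\<close> would become negative.
\<close>

lemma W_0: "W 0 = 0"
proof (rule ccontr)
  assume "W 0 \<noteq> 0"
  then have w: "0 < W 0" using W_nonneg[of 0] by simp
  have le: "W 0 / u \<le> 1 / \<psi> u" if u: "0 < u" for u
  proof -
    have "ennreal (W 0 * (1 / u)) = ennreal (W 0) * (\<integral>\<^sup>+x. ennreal (exp (- u * x)) * indicator {0<..} x \<partial>lborel)"
      using u w nn_integral_exp_greaterThan[OF u, of 0] by (simp flip: ennreal_mult)
    also have "\<dots> = (\<integral>\<^sup>+x. ennreal (W 0) * (ennreal (exp (- u * x)) * indicator {0<..} x) \<partial>lborel)"
      by (rule nn_integral_cmult[symmetric]) measurable
    also have "\<dots> \<le> (\<integral>\<^sup>+x. ennreal (exp (- u * x) * W x) \<partial>lborel)"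
    proof (rule nn_integral_mono)
      fix x
      show "ennreal (W 0) * (ennreal (exp (- u * x)) * indicator {0<..} x) \<le> ennreal (exp (- u * x) * W x)"
        using monoD[OF W_mono, of 0 x] w
        by (cases "0 < x") (auto simp: mult.commute[of "W 0"] intro!: ennreal_leI mult_left_mono simp flip: ennreal_mult)
    qed
    also have "\<dots> = ennreal (1 / \<psi> u)" by (rule W_laplace[OF u])
    finally show ?thesis using psi_pos[OF u] by simp
  qed
  \<comment> \<open>From \<open>1\<close> on, \<open>\<phi> + W(0) ln\<close> does not increase; \<open>u\<close> is chosen so that this forces \<open>\<phi>(u) \<le> -1\<close>.\<close>
  define u where "u = exp ((\<Phi> 1 + 1) / W 0)"
  have phi_nonneg: "0 \<le> \<Phi> s" if "0 < s" for s
    unfolding phi_def set_lebesgue_integral_def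
  proof (rule integral_nonneg_AE, rule always_eventually, rule allI)
    show "0 \<le> indicator {s..} x *\<^sub>R (1 / \<psi> x)" for x
      using psi_pos[of x] that by (auto simp: indicator_def)
  qed
  have u: "1 \<le> u" using phi_nonneg[of 1] w by (simp add: u_def)
  have "\<Phi> u + W 0 * ln u \<le> \<Phi> 1 + W 0 * ln 1"
  proof (rule DERIV_nonpos_imp_nonincreasing[OF u])
    fix x :: real assume "1 \<le> x"
    then show "\<exists>y. ((\<lambda>x. \<Phi> x + W 0 * ln x) has_real_derivative y) (at x) \<and> y \<le> 0"
      using le[of x] phi_deriv[of x]
      by (intro exI[of _ "- (1 / \<psi> x) + W 0 * (1 / x)"]) (auto intro!: derivative_eq_intros)
  qed
  moreover have "W 0 * ln u = \<Phi> 1 + 1" using w by (simp add: u_def)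
  ultimately show False using phi_nonneg[of u] u by simp
qed

lemma W'_nonneg: "0 < x \<Longrightarrow> 0 \<le> W' x"
  using mono_on_imp_deriv_nonneg[of UNIV W "W' x" x] W_mono W_deriv by simp

text \<open>
  \<open>W'\<close> extended by \<open>0\<close>, which makes it measurable on the whole line.
\<close>

definition Wd :: "real \<Rightarrow> real" where "Wd x = indicator {0<..} x * W' x"

lemma Wd_nonneg: "0 \<le> Wd x"
  using W'_nonneg by (simp add: Wd_def indicator_def)

lemma Wd_measurable [measurable]: "Wd \<in> borel_measurable borel"
  using borel_measurable_continuous_on_indicator[OF _ W_deriv_cont] by (simp add: Wd_def[abs_def])

lemma nn_integral_Wd:
  assumes x: "0 < x"
  shows "(\<integral>\<^sup>+y. ennreal (Wd y) * indicator {..<x} y \<partial>lborel) = ennreal (W x)"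
proof -
  have "(W \<longlongrightarrow> W x) (at_left x)"
    using DERIV_isCont[OF W_deriv[OF x]] by (simp add: isCont_def filterlim_at_split)
  moreover have "(W \<longlongrightarrow> 0) (at_right 0)"
  proof -
    have "continuous_on {0..} W" using scale by (simp add: scale_function_def)
    then have "(W \<longlongrightarrow> W 0) (at 0 within {0..})" by (simp add: continuous_on_def)
    then have "(W \<longlongrightarrow> W 0) (at 0 within {0<..})" by (rule tendsto_within_subset) auto
    then show ?thesis using W_0 by simp
  qed
  ultimately have lims: "((W \<circ> real_of_ereal) \<longlongrightarrow> 0) (at_right (ereal 0))" "((W \<circ> real_of_ereal) \<longlongrightarrow> W x) (at_left (ereal x))"
    unfolding ereal_tendsto_simps by blast+
  have cont: "isCont W' y" if "0 < y" for y
    using W_deriv_cont that by (simp add: continuous_on_eq_continuous_at)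
  note FTC = interval_integral_FTC_nonneg[of "ereal 0" "ereal x" W W', OF _ _ _ _ lims]
  have "set_integrable lborel (einterval (ereal 0) (ereal x)) W'" "(LBINT y=ereal 0..ereal x. W' y) = W x - 0"
    by (rule FTC; use x W_deriv cont W'_nonneg in \<open>auto intro!: always_eventually\<close>)+
  then have *: "integrable lborel (\<lambda>y. indicator {0<..<x} y *\<^sub>R W' y)" "(LINT y|lborel. indicator {0<..<x} y *\<^sub>R W' y) = W x"
    using x by (auto simp: interval_lebesgue_integral_le_eq set_integrable_def set_lebesgue_integral_def)
  have "(\<integral>\<^sup>+y. ennreal (Wd y) * indicator {..<x} y \<partial>lborel) = (\<integral>\<^sup>+y. ennreal (indicator {0<..<x} y *\<^sub>R W' y) \<partial>lborel)"
    by (intro nn_integral_cong) (auto simp: Wd_def indicator_def)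
  also have "\<dots> = ennreal (W x)"
    using nn_integral_eq_integral[OF *(1)] *(2) W'_nonneg by (simp add: indicator_def)
  finally show ?thesis .
qed

text \<open>
  Integration by parts, carried out as Tonelli's theorem for \<open>W(x) = \<integral>\<^sub>0\<^sup>x W'(y) dy\<close>.
\<close>

lemma Wd_laplace:
  assumes u: "0 < u"
  shows "(\<integral>\<^sup>+x. ennreal (exp (- u * x) * Wd x) \<partial>lborel) = ennreal (u / \<psi> u)"
proof -
  define k where "k x y = ennreal (Wd y) * (ennreal (exp (- u * x)) * indicator {y<..} x)" for x y
  have k_meas: "(\<lambda>(y, x). k x y) \<in> borel_measurable (lborel \<Otimes>\<^sub>M lborel)"
    unfolding k_def case_prod_beta by (simp add: greaterThan_def indicator_def cong: if_cong) measurable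
  have "ennreal (1 / \<psi> u) = (\<integral>\<^sup>+x. ennreal (exp (- u * x) * W x) \<partial>lborel)"
    using W_laplace[OF u] by simp
  also have "\<dots> = (\<integral>\<^sup>+x. \<integral>\<^sup>+y. k x y \<partial>lborel \<partial>lborel)"
  proof (rule nn_integral_cong)
    fix x :: real
    have "(\<integral>\<^sup>+y. k x y \<partial>lborel) = (\<integral>\<^sup>+y. ennreal (exp (- u * x)) * (ennreal (Wd y) * indicator {..<x} y) \<partial>lborel)"
      by (intro nn_integral_cong) (auto simp: k_def indicator_def mult_ac)
    also have "\<dots> = ennreal (exp (- u * x)) * (\<integral>\<^sup>+y. ennreal (Wd y) * indicator {..<x} y \<partial>lborel)"
      by (rule nn_integral_cmult) measurable
    also have "(\<integral>\<^sup>+y. ennreal (Wd y) * indicator {..<x} y \<partial>lborel) = ennreal (W x)"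
    proof (cases "0 < x")
      case True
      then show ?thesis by (rule nn_integral_Wd)
    next
      case False
      then have "W x = 0" using W_neg[of x] W_0 by (cases "x = 0") auto
      moreover have z: "ennreal (Wd y) * indicator {..<x} y = 0" for y
        using False by (auto simp: Wd_def indicator_def)
      have "(\<integral>\<^sup>+y. ennreal (Wd y) * indicator {..<x} y \<partial>lborel) = 0"
        unfolding z by simp
      ultimately show ?thesis by simp
    qed
    finally show "ennreal (exp (- u * x) * W x) = (\<integral>\<^sup>+y. k x y \<partial>lborel)"
      by (simp add: ennreal_mult W_nonneg)
  qed
  also have "\<dots> = (\<integral>\<^sup>+y. \<integral>\<^sup>+x. k x y \<partial>lborel \<partial>lborel)"
    using lborel_pair.Fubini'[OF k_meas] by simp
  also have "\<dots> = (\<integral>\<^sup>+y. ennreal (1 / u) * ennreal (exp (- u * y) * Wd y) \<partial>lborel)"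
  proof (rule nn_integral_cong)
    fix y :: real
    have "(\<integral>\<^sup>+x. k x y \<partial>lborel) = ennreal (Wd y) * ennreal (exp (- u * y) / u)"
      unfolding k_def nn_integral_exp_greaterThan[OF u, symmetric] by (rule nn_integral_cmult) measurable
    also have "\<dots> = ennreal (1 / u) * ennreal (exp (- u * y) * Wd y)"
      using u Wd_nonneg[of y] by (simp add: mult_ac flip: ennreal_mult)
    finally show "(\<integral>\<^sup>+x. k x y \<partial>lborel) = ennreal (1 / u) * ennreal (exp (- u * y) * Wd y)" .
  qed
  also have "\<dots> = ennreal (1 / u) * (\<integral>\<^sup>+y. ennreal (exp (- u * y) * Wd y) \<partial>lborel)"
    by (rule nn_integral_cmult) measurable
  finally have "ennreal u * ennreal (1 / \<psi> u) = ennreal u * (ennreal (1 / u) * (\<integral>\<^sup>+y. ennreal (exp (- u * y) * Wd y) \<partial>lborel))"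
    by simp
  then show ?thesis using u psi_pos[OF u] by (simp flip: mult.assoc ennreal_mult)
qed

lemma W_increment_laplace:
  assumes u: "0 < u" and r: "0 < r"
  shows "(\<integral>\<^sup>+x. ennreal (exp (- u * x) * (W x - W (x - r))) \<partial>lborel) = ennreal ((1 - exp (- u * r)) / \<psi> u)"
proof -
  have "(\<integral>\<^sup>+x. ennreal (exp (- u * x) * W (x - r)) \<partial>lborel) = (\<integral>\<^sup>+x. ennreal (exp (- u * (r + x)) * W x) \<partial>lborel)"
    by (subst nn_integral_real_affine[of _ 1 r]) auto
  also have "\<dots> = (\<integral>\<^sup>+x. ennreal (exp (- u * r)) * ennreal (exp (- u * x) * W x) \<partial>lborel)"
  proof (rule nn_integral_cong)
    fix x
    have "exp (- u * (r + x)) = exp (- u * r) * exp (- u * x)"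
      by (simp add: distrib_left flip: exp_add)
    then show "ennreal (exp (- u * (r + x)) * W x) = ennreal (exp (- u * r)) * ennreal (exp (- u * x) * W x)"
      by (simp only: mult.assoc, intro ennreal_mult) (simp_all add: W_nonneg)
  qed
  also have "\<dots> = ennreal (exp (- u * r)) * ennreal (1 / \<psi> u)"
    by (subst nn_integral_cmult) (auto simp: W_laplace[OF u, simplified])
  also have "\<dots> = ennreal (exp (- u * r) / \<psi> u)"
    using psi_pos[OF u] by (simp flip: ennreal_mult)
  finally have sh: "(\<integral>\<^sup>+x. ennreal (exp (- u * x) * W (x - r)) \<partial>lborel) = ennreal (exp (- u * r) / \<psi> u)" .
  have "(\<integral>\<^sup>+x. ennreal (exp (- u * x) * (W x - W (x - r))) \<partial>lborel)
      = (\<integral>\<^sup>+x. ennreal (exp (- u * x) * W x) - ennreal (exp (- u * x) * W (x - r)) \<partial>lborel)"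
    by (intro nn_integral_cong) (simp add: W_nonneg right_diff_distrib ennreal_minus)
  also have "\<dots> = (\<integral>\<^sup>+x. ennreal (exp (- u * x) * W x) \<partial>lborel) - (\<integral>\<^sup>+x. ennreal (exp (- u * x) * W (x - r)) \<partial>lborel)"
  proof (rule nn_integral_diff)
    show "AE x in lborel. ennreal (exp (- u * x) * W (x - r)) \<le> ennreal (exp (- u * x) * W x)"
      using r by (intro always_eventually allI ennreal_leI mult_left_mono monoD[OF W_mono]) auto
  qed (use sh in auto)
  also have "\<dots> = ennreal (1 / \<psi> u - exp (- u * r) / \<psi> u)"
    unfolding sh W_laplace[OF u] using psi_pos[OF u] by (simp add: ennreal_minus)
  finally show ?thesis by (simp add: diff_divide_distrib)
qed

text \<open>
  Small \<open>r\<close> are controlled by the derivative of \<open>W\<close> on \<open>[x / 2, x]\<close>, which gives a bound of order \<open>r\<^sup>2\<close>,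
  and the other \<open>r\<close> by \<open>W(x) r\<close>.
\<close>

lemma W_increment_integrable:
  assumes x: "0 < x"
  shows "set_integrable \<pi> {0<..} (\<lambda>r. (W x - W (x - r)) * r)"
proof -
  have "continuous_on {x / 2..x} W'" by (rule continuous_on_subset[OF W_deriv_cont]) (use x in auto)
  then have "compact (W' ` {x / 2..x})" by (intro compact_continuous_image) auto
  then obtain M where M': "\<forall>z \<in> W' ` {x / 2..x}. norm z \<le> M" and M0: "0 < M"
    using compact_imp_bounded[of "W' ` {x / 2..x}"] unfolding bounded_pos by blast
  have M: "\<bar>W' y\<bar> \<le> M" if "y \<in> {x / 2..x}" for y
    using M' that by simp
  \<comment> \<open>Large enough for both regimes and for both members of \<open>min r (r\<^sup>2)\<close>.\<close>
  define C where "C = M * (1 + x) + W x * (1 + 2 / x)"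
  have C: "M \<le> C" "M * x \<le> C" "W x \<le> C" "W x * (2 / x) \<le> C"
    using M0 x W_nonneg[of x] by (auto simp: C_def algebra_simps)
  show ?thesis
  proof (rule pi_dominated)
    fix r :: real assume r: "0 < r"
    have nn: "0 \<le> (W x - W (x - r)) * r" using r monoD[OF W_mono, of "x - r" x] by simp
    have "(W x - W (x - r)) * r \<le> C * r \<and> (W x - W (x - r)) * r \<le> C * r\<^sup>2"
    proof (cases "r < x / 2")
      case True
      have "norm (W x - W (x - r)) \<le> M * norm (x - (x - r))"
        by (rule field_differentiable_bound[where S = "{x / 2..x}" and f' = W'])
          (use M True r x W_deriv in \<open>auto intro: has_field_derivative_at_within\<close>)
      then have "W x - W (x - r) \<le> M * r" using r by simp
      then have *: "(W x - W (x - r)) * r \<le> M * r * r" using r by (intro mult_right_mono) auto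
      have "M * r \<le> M * x" using True x M0 r by (intro mult_left_mono) auto
      then have "M * r * r \<le> C * r" using C r by (intro mult_right_mono) auto
      moreover have "M * r * r \<le> C * r\<^sup>2"
        using C(1) r by (simp add: power2_eq_square mult.assoc mult_right_mono)
      ultimately show ?thesis using * by linarith
    next
      case False
      have "W x - W (x - r) \<le> W x" using W_nonneg by simp
      then have *: "(W x - W (x - r)) * r \<le> W x * r" using r by (intro mult_right_mono) auto
      have "W x * r \<le> C * r" using C r by (intro mult_right_mono) auto
      moreover have "W x * r \<le> C * r\<^sup>2"
      proof -
        have "1 \<le> 2 / x * r" using False x by (simp add: field_simps)
        then have "W x * 1 \<le> W x * (2 / x * r)" using W_nonneg[of x] by (rule mult_left_mono)
        also have "\<dots> \<le> C * r" using mult_right_mono[OF C(4), of r] r by (simp add: mult.assoc)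
        finally have "W x * r \<le> C * r * r" using r by (intro mult_right_mono) auto
        then show ?thesis by (simp add: power2_eq_square mult.assoc)
      qed
      ultimately show ?thesis using * by linarith
    qed
    then show "\<bar>(W x - W (x - r)) * r\<bar> \<le> C * min r (r\<^sup>2)" using nn by (auto simp: min_def)
  qed measurable
qed

text \<open>
  \<open>v_infinity\<close> extended by \<open>0\<close>, like \<open>W\<close> and \<open>W'\<close>, so that all Laplace transforms are integrals over
  the whole line.
\<close>

definition v :: "real \<Rightarrow> real" where "v x = indicator {0<..} x * v_infinity \<sigma> \<pi> W W' x"

lemma v_eq: "v x = \<sigma>\<^sup>2 * Wd x + indicator {0<..} x * (LINT r:{0<..}|\<pi>. (W x - W (x - r)) * r)"
  by (auto simp: v_def v_infinity_def Wd_def indicator_def)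

lemma W_increment_nonneg: "0 \<le> indicator {0<..} r * ((W x - W (x - r)) * r)"
  using monoD[OF W_mono, of "x - r" x] by (auto simp: indicator_def)

lemma v_nonneg: "0 \<le> v x"
  unfolding v_eq using W_increment_nonneg Wd_nonneg
  by (auto intro!: add_nonneg_nonneg mult_nonneg_nonneg integral_nonneg_AE always_eventually
      simp: set_lebesgue_integral_def)

lemma v_measurable [measurable]: "v \<in> borel_measurable borel"
proof -
  interpret sigma_finite_measure \<pi> by (rule sigma_finite_pi)
  show ?thesis unfolding v_eq[abs_def] set_lebesgue_integral_def by measurable
qed

lemma v_nn_integral:
  "ennreal (v x) = ennreal (\<sigma>\<^sup>2) * ennreal (Wd x) + (\<integral>\<^sup>+r. ennreal (indicator {0<..} r * ((W x - W (x - r)) * r)) \<partial>\<pi>)"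
proof (cases "0 < x")
  case True
  have i: "integrable \<pi> (\<lambda>r. indicator {0<..} r * ((W x - W (x - r)) * r))"
    using W_increment_integrable[OF True] by (simp add: set_integrable_def)
  have "v x = \<sigma>\<^sup>2 * Wd x + (LINT r|\<pi>. indicator {0<..} r * ((W x - W (x - r)) * r))"
    using True by (simp add: v_eq set_lebesgue_integral_def)
  also have "ennreal \<dots> = ennreal (\<sigma>\<^sup>2 * Wd x) + ennreal (LINT r|\<pi>. indicator {0<..} r * ((W x - W (x - r)) * r))"
    by (rule ennreal_plus[OF _ integral_nonneg_AE[OF always_eventually]]) (use W_increment_nonneg Wd_nonneg in auto)
  also have "ennreal (LINT r|\<pi>. indicator {0<..} r * ((W x - W (x - r)) * r))
     = (\<integral>\<^sup>+r. ennreal (indicator {0<..} r * ((W x - W (x - r)) * r)) \<partial>\<pi>)"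
    by (rule nn_integral_eq_integral[OF i, symmetric]) (use W_increment_nonneg in auto)
  finally show ?thesis by (simp add: ennreal_mult Wd_nonneg)
next
  case False
  have z: "W y = 0" if "y \<le> 0" for y using that W_neg[of y] W_0 by (cases "y = 0") auto
  have "indicator {0<..} r * ((W x - W (x - r)) * r) = 0" for r
    using False z[of x] z[of "x - r"] by (auto simp: indicator_def)
  then have "(\<integral>\<^sup>+r. ennreal (indicator {0<..} r * ((W x - W (x - r)) * r)) \<partial>\<pi>) = (\<integral>\<^sup>+r. 0 \<partial>\<pi>)"
    by (intro nn_integral_cong) (simp only: ennreal_0)
  then show ?thesis using False by (simp add: v_eq Wd_def)
qed

text \<open>
  Here the scale function enters: the Laplace transforms of \<open>W'\<close> and of the increments of \<open>W\<close> have the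
  common factor \<open>1 / \<psi>(u)\<close>, and what remains is \<open>\<sigma>\<^sup>2 u + \<integral> r (1 - exp (- u r)) \<pi>(dr) = \<psi>'(u) - \<alpha>\<close>.
\<close>

lemma v_laplace:
  assumes u: "0 < u"
  shows "(\<integral>\<^sup>+x. ennreal (exp (- u * x) * v x) \<partial>lborel) = ennreal (exponent_rate u)"
proof -
  interpret pi: sigma_finite_measure \<pi> by (rule sigma_finite_pi)
  interpret P: pair_sigma_finite lborel \<pi> ..
  define k where "k x r = ennreal (exp (- u * x)) * ennreal (indicator {0<..} r * ((W x - W (x - r)) * r))" for x r
  have k_meas: "case_prod k \<in> borel_measurable (lborel \<Otimes>\<^sub>M \<pi>)"
    unfolding k_def[abs_def] case_prod_beta by measurable
  have "(\<integral>\<^sup>+x. ennreal (exp (- u * x) * v x) \<partial>lborel)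
      = (\<integral>\<^sup>+x. ennreal (\<sigma>\<^sup>2) * ennreal (exp (- u * x) * Wd x) + (\<integral>\<^sup>+r. k x r \<partial>\<pi>) \<partial>lborel)"
  proof (rule nn_integral_cong)
    fix x
    have "ennreal (exp (- u * x) * v x) = ennreal (exp (- u * x)) * ennreal (v x)"
      by (rule ennreal_mult) (auto simp: v_nonneg)
    also have "\<dots> = ennreal (exp (- u * x)) * (ennreal (\<sigma>\<^sup>2) * ennreal (Wd x))
        + ennreal (exp (- u * x)) * (\<integral>\<^sup>+r. ennreal (indicator {0<..} r * ((W x - W (x - r)) * r)) \<partial>\<pi>)"
      unfolding v_nn_integral by (rule distrib_left)
    also have "ennreal (exp (- u * x)) * (\<integral>\<^sup>+r. ennreal (indicator {0<..} r * ((W x - W (x - r)) * r)) \<partial>\<pi>) = (\<integral>\<^sup>+r. k x r \<partial>\<pi>)"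
      unfolding k_def by (rule nn_integral_cmult[symmetric]) measurable
    also have "ennreal (exp (- u * x)) * (ennreal (\<sigma>\<^sup>2) * ennreal (Wd x)) = ennreal (\<sigma>\<^sup>2) * ennreal (exp (- u * x) * Wd x)"
      by (simp add: ennreal_mult Wd_nonneg mult_ac)
    finally show "ennreal (exp (- u * x) * v x) = ennreal (\<sigma>\<^sup>2) * ennreal (exp (- u * x) * Wd x) + (\<integral>\<^sup>+r. k x r \<partial>\<pi>)" .
  qed
  also have "\<dots> = (\<integral>\<^sup>+x. ennreal (\<sigma>\<^sup>2) * ennreal (exp (- u * x) * Wd x) \<partial>lborel) + (\<integral>\<^sup>+x. \<integral>\<^sup>+r. k x r \<partial>\<pi> \<partial>lborel)"
    by (rule nn_integral_add) (use pi.borel_measurable_nn_integral[OF k_meas] in auto)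
  also have "(\<integral>\<^sup>+x. ennreal (\<sigma>\<^sup>2) * ennreal (exp (- u * x) * Wd x) \<partial>lborel) = ennreal (\<sigma>\<^sup>2) * ennreal (u / \<psi> u)"
    unfolding Wd_laplace[OF u, symmetric] by (rule nn_integral_cmult) measurable
  also have "(\<integral>\<^sup>+x. \<integral>\<^sup>+r. k x r \<partial>\<pi> \<partial>lborel) = (\<integral>\<^sup>+r. \<integral>\<^sup>+x. k x r \<partial>lborel \<partial>\<pi>)"
    by (rule P.Fubini'[OF k_meas, symmetric])
  also have "\<dots> = (\<integral>\<^sup>+r. ennreal (indicator {0<..} r * (r * (1 - exp (- u * r)) / u)) * ennreal (u / \<psi> u) \<partial>\<pi>)"
  proof (rule nn_integral_cong)
    fix r :: real
    show "(\<integral>\<^sup>+x. k x r \<partial>lborel) = ennreal (indicator {0<..} r * (r * (1 - exp (- u * r)) / u)) * ennreal (u / \<psi> u)"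
    proof (cases "0 < r")
      case True
      have "(\<integral>\<^sup>+x. k x r \<partial>lborel) = (\<integral>\<^sup>+x. ennreal r * ennreal (exp (- u * x) * (W x - W (x - r))) \<partial>lborel)"
        using True monoD[OF W_mono, of "_ - r"] by (intro nn_integral_cong) (auto simp: k_def mult_ac simp flip: ennreal_mult)
      also have "\<dots> = ennreal r * ennreal ((1 - exp (- u * r)) / \<psi> u)"
        unfolding W_increment_laplace[OF u True, symmetric] by (rule nn_integral_cmult) measurable
      also have "\<dots> = ennreal (r * ((1 - exp (- u * r)) / \<psi> u))"
        using True u psi_pos[OF u] by (intro ennreal_mult[symmetric]) auto
      also have "r * ((1 - exp (- u * r)) / \<psi> u) = (r * (1 - exp (- u * r)) / u) * (u / \<psi> u)"
        using u by simp
      also have "ennreal \<dots> = ennreal (r * (1 - exp (- u * r)) / u) * ennreal (u / \<psi> u)"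
        using True u psi_pos[OF u] by (intro ennreal_mult) auto
      finally show ?thesis using True by simp
    qed (simp add: k_def)
  qed
  also have "\<dots> = (\<integral>\<^sup>+r. ennreal (indicator {0<..} r * (r * (1 - exp (- u * r)) / u)) \<partial>\<pi>) * ennreal (u / \<psi> u)"
    by (rule nn_integral_multc) measurable
  finally have "(\<integral>\<^sup>+x. ennreal (exp (- u * x) * v x) \<partial>lborel) = ennreal ((dpsi u - \<alpha>) / u) * ennreal (u / \<psi> u)"
    unfolding dpsi_nn_integral[OF u] by (simp add: distrib_right)
  also have "\<dots> = ennreal (exponent_rate u)"
    using u psi_pos[OF u] dpsi_ge[of u] by (simp add: exponent_rate_def flip: ennreal_mult)
  finally show ?thesis .
qed

text \<open>
  The exponent is \<open>\<integral>\<^sub>0\<^sup>u \<integral> exp (- s x) v(x) dx ds\<close>; exchanging the integrals produces the kernel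
  \<open>(1 - exp (- u x)) / x\<close>.
\<close>

lemma v_levy_khintchine:
  assumes rate_integrable: "\<And>u. 0 < u \<Longrightarrow> set_integrable lborel {0<..<u} exponent_rate"
    and l: "\<And>u. 0 < u \<Longrightarrow> l u = (LINT s:{0<..<u}|lborel. exponent_rate s)"
  shows "levy_khintchine l 0 (\<lambda>x. v_infinity \<sigma> \<pi> W W' x / x)"
proof -
  define f where "f u x = indicator {0<..} x * ((1 - exp (- u * x)) * (v x / x))" for u x
  have f_nonneg: "0 \<le> f u x" if "0 < u" for u x
    using v_nonneg[of x] that by (auto simp: f_def indicator_def)
  have fl: "(\<integral>\<^sup>+x. ennreal (f u x) \<partial>lborel) = ennreal (l u)" if u: "0 < u" for u
  proof -
    define k where "k x s = ennreal (v x) * (ennreal (exp (- s * x)) * indicator {0<..<u} s)" for x s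
    have k_meas: "case_prod k \<in> borel_measurable (lborel \<Otimes>\<^sub>M lborel)"
      unfolding k_def[abs_def] case_prod_beta by measurable
    have "(\<integral>\<^sup>+x. ennreal (f u x) \<partial>lborel) = (\<integral>\<^sup>+x. \<integral>\<^sup>+s. k x s \<partial>lborel \<partial>lborel)"
    proof (rule nn_integral_cong)
      fix x :: real
      show "ennreal (f u x) = (\<integral>\<^sup>+s. k x s \<partial>lborel)"
      proof (cases "0 < x")
        case True
        have "(\<integral>\<^sup>+s. k x s \<partial>lborel) = ennreal (v x) * ennreal ((1 - exp (- u * x)) / x)"
          unfolding k_def nn_integral_exp_initial[OF u True, symmetric] by (rule nn_integral_cmult) measurable
        then show ?thesis using True u v_nonneg[of x] by (simp add: f_def mult_ac flip: ennreal_mult)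
      qed (simp add: f_def k_def v_def)
    qed
    also have "\<dots> = (\<integral>\<^sup>+s. \<integral>\<^sup>+x. k x s \<partial>lborel \<partial>lborel)"
      by (rule lborel_pair.Fubini'[OF k_meas, symmetric])
    also have "\<dots> = (\<integral>\<^sup>+s. ennreal (indicator {0<..<u} s *\<^sub>R exponent_rate s) \<partial>lborel)"
    proof (rule nn_integral_cong)
      fix s :: real
      show "(\<integral>\<^sup>+x. k x s \<partial>lborel) = ennreal (indicator {0<..<u} s *\<^sub>R exponent_rate s)"
      proof (cases "0 < s \<and> s < u")
        case True
        then have "(\<integral>\<^sup>+x. k x s \<partial>lborel) = (\<integral>\<^sup>+x. ennreal (exp (- s * x) * v x) \<partial>lborel)"
          using v_nonneg by (intro nn_integral_cong) (simp add: k_def mult_ac flip: ennreal_mult)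
        then show ?thesis using True v_laplace[of s] by simp
      qed (auto simp: k_def indicator_def)
    qed
    also have "\<dots> = ennreal (l u)"
      unfolding l[OF u] set_lebesgue_integral_def
      using rate_integrable[OF u] exponent_rate_nonneg by (intro nn_integral_eq_integral) (auto simp: set_integrable_def indicator_def)
    finally show ?thesis .
  qed
  have l_nonneg: "0 \<le> l u" if "0 < u" for u
    unfolding l[OF that] set_lebesgue_integral_def using exponent_rate_nonneg
    by (intro integral_nonneg_AE always_eventually) (auto simp: indicator_def)
  have f_meas [measurable]: "f u \<in> borel_measurable borel" for u unfolding f_def[abs_def] by measurable
  have f_int: "integrable lborel (f u)" "integral\<^sup>L lborel (f u) = l u" if u: "0 < u" for u
  proof -
    show i: "integrable lborel (f u)"
      by (rule integrableI_nonneg) (use f_nonneg[OF u] fl[OF u] in auto)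
    show "integral\<^sup>L lborel (f u) = l u"
      using integral_eq_nn_integral[of "f u" lborel] f_nonneg[OF u] fl[OF u] l_nonneg[OF u] by simp
  qed
  have v_eq': "indicator {0<..} x *\<^sub>R (c * (v_infinity \<sigma> \<pi> W W' x / x)) = indicator {0<..} x * (c * (v x / x))"
    for c x :: real
    by (auto simp: v_def indicator_def)
  show ?thesis
    unfolding levy_khintchine_def
  proof (intro conjI allI impI)
    show "0 \<le> v_infinity \<sigma> \<pi> W W' x / x" if "0 < x" for x
      using v_nonneg[of x] that by (simp add: v_def)
    show "set_integrable lborel {0<..} (\<lambda>x. min 1 x * (v_infinity \<sigma> \<pi> W W' x / x))"
      unfolding set_integrable_def v_eq'
    proof (rule Bochner_Integration.integrable_bound[OF integrable_mult_right[OF f_int(1)[of 1], of "2"]])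
      show "AE x in lborel. norm (indicator {0<..} x * (min 1 x * (v x / x))) \<le> norm (2 * f 1 x)"
      proof (intro always_eventually allI)
        fix x :: real
        have "min 1 x * (v x / x) \<le> 2 * (1 - exp (- x)) * (v x / x)" if x: "0 < x"
        proof (rule mult_right_mono)
          have "min 1 x \<le> 2 * (x / (1 + x))" using x by (auto simp: min_def field_simps)
          also have "\<dots> \<le> 2 * (1 - exp (- x))"
            using x by (intro mult_left_mono exp_minus_bounds(3)) auto
          finally show "min 1 x \<le> 2 * (1 - exp (- x))" .
        qed (use x v_nonneg[of x] in auto)
        then have "indicator {0<..} x * (min 1 x * (v x / x)) \<le> 2 * f 1 x"
          by (cases "0 < x") (simp_all add: f_def algebra_simps diff_divide_distrib)
        moreover have "0 \<le> indicator {0<..} x * (min 1 x * (v x / x))"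
          using v_nonneg[of x] by (cases "0 < x") simp_all
        ultimately show "norm (indicator {0<..} x * (min 1 x * (v x / x))) \<le> norm (2 * f 1 x)"
          unfolding real_norm_def by linarith
      qed
    qed auto
    show "l u = 0 * u + (LINT x:{0<..}|lborel. (1 - exp (- u * x)) * (v_infinity \<sigma> \<pi> W W' x / x))" if "0 < u" for u
      using f_int(2)[OF that] unfolding set_lebesgue_integral_def v_eq' f_def[abs_def] by simp
  qed simp
qed

end

section \<open>The size-biased Yaglom distribution\<close>

lemma exp_times_bound:
  fixes s x :: real
  assumes "0 < s" "0 \<le> x"
  shows "x * exp (- s * x) \<le> 1 / s"
proof -
  have "s * x \<le> exp (s * x)" using exp_ge_add_one_self[of "s * x"] by linarith
  then show ?thesis using assms by (simp add: exp_minus field_simps)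
qed

context branching_mechanism
begin

lemma exp_exponent_potential: "0 < u \<Longrightarrow> exp (exponent_potential u) = \<psi> u * exp (\<alpha> * \<Phi> u)"
  using psi_pos by (simp add: exponent_potential_def exp_add)

text \<open>
  The factor \<open>exp (\<alpha> q)\<close> is absorbed through \<open>q = \<phi>(\<epsilon>)\<close>.
\<close>

lemma conditioned_laplace_eq:
  assumes q: "\<Phi> 1 \<le> q" and s: "0 < s"
  defines "\<epsilon> \<equiv> varphi \<alpha> \<sigma> \<pi> q"
  shows "exp (- \<alpha> * (\<Phi> (s + \<epsilon>) - q)) * (\<psi> \<epsilon> / \<psi> (s + \<epsilon>)) = exp (exponent_potential \<epsilon> - exponent_potential (s + \<epsilon>))"
proof -
  have \<epsilon>: "0 < \<epsilon>" "\<Phi> \<epsilon> = q" unfolding \<epsilon>_def by (rule varphi_props[OF q])+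
  have "exp (exponent_potential \<epsilon> - exponent_potential (s + \<epsilon>)) = (\<psi> \<epsilon> * exp (\<alpha> * q)) / (\<psi> (s + \<epsilon>) * exp (\<alpha> * \<Phi> (s + \<epsilon>)))"
    using \<epsilon> s by (simp add: exp_diff exp_exponent_potential)
  also have "\<dots> = exp (\<alpha> * q) / exp (\<alpha> * \<Phi> (s + \<epsilon>)) * (\<psi> \<epsilon> / \<psi> (s + \<epsilon>))" by (simp add: mult.commute)
  also have "exp (\<alpha> * q) / exp (\<alpha> * \<Phi> (s + \<epsilon>)) = exp (- \<alpha> * (\<Phi> (s + \<epsilon>) - q))"
    by (simp add: algebra_simps flip: exp_diff)
  finally show ?thesis ..
qed

lemma exponent_potential_shift_tendsto:
  assumes s: "0 < s"
  shows "((\<lambda>e. exponent_potential (s + e)) \<longlongrightarrow> exponent_potential s) (at_right 0)"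
proof (rule isCont_tendsto_compose[OF DERIV_isCont[OF exponent_potential_deriv[OF s]]])
  show "((\<lambda>e. s + e) \<longlongrightarrow> s) (at_right 0)" by (auto intro!: tendsto_eq_intros)
qed

text \<open>
  Differentiating \<open>1 - exp (- \<alpha> \<phi>(s))\<close> gives \<open>- \<alpha> exp (- \<alpha> \<phi>(s)) / \<psi>(s)\<close>, which is
  \<open>- \<alpha>\<close> times the exponential of \<open>- exponent_potential s\<close>.
\<close>

lemma yaglom_derivative:
  assumes \<Theta>: "positive_random_variable N \<Theta>"
    and laplace: "\<And>s. 0 < s \<Longrightarrow> (LINT \<omega>|N. exp (- s * \<Theta> \<omega>)) = 1 - exp (- \<alpha> * \<Phi> s)"
    and s: "0 < s"
  shows "integrable N (\<lambda>\<omega>. \<Theta> \<omega> * exp (- s * \<Theta> \<omega>))"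
    and "(LINT \<omega>|N. \<Theta> \<omega> * exp (- s * \<Theta> \<omega>)) = \<alpha> * exp (- exponent_potential s)"
proof -
  interpret prob_space N using \<Theta> by (simp add: positive_random_variable_def)
  have [measurable]: "\<Theta> \<in> borel_measurable N" and pos: "AE \<omega> in N. 0 < \<Theta> \<omega>"
    using \<Theta> by (auto simp: positive_random_variable_def)
  have int: "integrable N (\<lambda>\<omega>. exp (- x * \<Theta> \<omega>))" if "0 < x" for x
  proof (rule integrable_const_bound[of _ 1])
    show "AE \<omega> in N. norm (exp (- x * \<Theta> \<omega>)) \<le> 1" using pos by eventually_elim (use that in simp)
  qed measurable
  have s2: "0 < s / 2" using s by simp
  have "((\<lambda>x. LINT \<omega>|N. exp (- x * \<Theta> \<omega>)) has_real_derivative (LINT \<omega>|N. - (\<Theta> \<omega> * exp (- s * \<Theta> \<omega>)))) (at s)"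
  proof (rule has_real_derivative_integral[where B = "\<lambda>_. 2 / s", OF s2])
    show "integrable N (\<lambda>\<omega>. exp (- x * \<Theta> \<omega>))" if "x \<in> ball s (s / 2)" for x
    proof (rule int)
      show "0 < x" using that s unfolding mem_ball dist_real_def by linarith
    qed
    show "AE \<omega> in N. \<forall>x\<in>ball s (s / 2).
        ((\<lambda>x. exp (- x * \<Theta> \<omega>)) has_real_derivative - (\<Theta> \<omega> * exp (- x * \<Theta> \<omega>))) (at x) \<and>
        \<bar>- (\<Theta> \<omega> * exp (- x * \<Theta> \<omega>))\<bar> \<le> 2 / s"
      using pos
    proof eventually_elim
      case (elim \<omega>)
      show ?case
      proof (intro ballI conjI)
        fix x assume "x \<in> ball s (s / 2)"
        then have x: "s / 2 < x" unfolding mem_ball dist_real_def by linarith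
        show "((\<lambda>x. exp (- x * \<Theta> \<omega>)) has_real_derivative - (\<Theta> \<omega> * exp (- x * \<Theta> \<omega>))) (at x)"
          by (auto intro!: derivative_eq_intros)
        have "\<Theta> \<omega> * exp (- x * \<Theta> \<omega>) \<le> 1 / x" using x s elim by (intro exp_times_bound) auto
        also have "1 / x \<le> 2 / s" using x s by (simp add: field_simps)
        finally show "\<bar>- (\<Theta> \<omega> * exp (- x * \<Theta> \<omega>))\<bar> \<le> 2 / s" using elim by (simp add: abs_mult)
      qed
    qed
  qed auto
  moreover have "((\<lambda>x. LINT \<omega>|N. exp (- x * \<Theta> \<omega>)) has_real_derivative - (\<alpha> * exp (- exponent_potential s))) (at s)"
  proof (rule has_field_derivative_transform_within_open[where S = "{0<..}"])
    have "exp (- exponent_potential s) = exp (- \<alpha> * \<Phi> s) / \<psi> s"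
      using exp_exponent_potential[OF s] psi_pos[OF s] by (simp add: exp_minus field_simps)
    then show "((\<lambda>s. 1 - exp (- \<alpha> * \<Phi> s)) has_real_derivative - (\<alpha> * exp (- exponent_potential s))) (at s)"
      by (auto intro!: derivative_eq_intros phi_deriv[OF s])
  qed (use s laplace in auto)
  ultimately have "(LINT \<omega>|N. - (\<Theta> \<omega> * exp (- s * \<Theta> \<omega>))) = - (\<alpha> * exp (- exponent_potential s))"
    by (rule DERIV_unique)
  then show "(LINT \<omega>|N. \<Theta> \<omega> * exp (- s * \<Theta> \<omega>)) = \<alpha> * exp (- exponent_potential s)" by simp
  show "integrable N (\<lambda>\<omega>. \<Theta> \<omega> * exp (- s * \<Theta> \<omega>))"
  proof (rule integrable_const_bound[of _ "1 / s"])
    show "AE \<omega> in N. norm (\<Theta> \<omega> * exp (- s * \<Theta> \<omega>)) \<le> 1 / s"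
      using pos by eventually_elim (use exp_times_bound[OF s] in \<open>simp add: abs_mult\<close>)
  qed measurable
qed

text \<open>
  Monotone convergence in the preceding formula along \<open>s = 1 / (n + 1)\<close>.
\<close>

lemma yaglom_mean:
  assumes \<Theta>: "positive_random_variable N \<Theta>"
    and laplace: "\<And>s. 0 < s \<Longrightarrow> (LINT \<omega>|N. exp (- s * \<Theta> \<omega>)) = 1 - exp (- \<alpha> * \<Phi> s)"
    and H0: "(exponent_potential \<longlongrightarrow> H0) (at_right 0)"
  shows "integrable N \<Theta>" "(LINT \<omega>|N. \<Theta> \<omega>) = \<alpha> * exp (- H0)"
proof -
  have [measurable]: "\<Theta> \<in> borel_measurable N" and pos: "AE \<omega> in N. 0 < \<Theta> \<omega>"
    using \<Theta> by (auto simp: positive_random_variable_def)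
  define e where "e n = 1 / real (Suc n)" for n
  have e: "0 < e n" for n by (simp add: e_def)
  have e0: "e \<longlonglongrightarrow> 0" unfolding e_def using LIMSEQ_inverse_real_of_nat by (simp add: inverse_eq_divide)
  have e_right: "filterlim e (at_right 0) sequentially"
    using e0 e by (auto simp: filterlim_at intro!: always_eventually less_imp_neq[symmetric])
  define f where "f n \<omega> = \<Theta> \<omega> * exp (- e n * \<Theta> \<omega>)" for n \<omega>
  have f: "integrable N (f n)" "integral\<^sup>L N (f n) = \<alpha> * exp (- exponent_potential (e n))" for n
    unfolding f_def by (rule yaglom_derivative[OF \<Theta> laplace e]; assumption)+
  have "AE \<omega> in N. mono (\<lambda>n. f n \<omega>)"
    using pos
  proof eventually_elim
    case (elim \<omega>)
    have "e m \<le> e n" if "n \<le> m" for n m using that by (simp add: e_def frac_le)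
    then show ?case using elim by (auto simp: mono_def f_def intro!: mult_left_mono mult_right_mono)
  qed
  moreover have "AE \<omega> in N. (\<lambda>n. f n \<omega>) \<longlonglongrightarrow> \<Theta> \<omega>"
  proof (intro always_eventually allI)
    fix \<omega>
    have "(\<lambda>n. f n \<omega>) \<longlonglongrightarrow> \<Theta> \<omega> * exp (- 0 * \<Theta> \<omega>)" unfolding f_def by (intro tendsto_intros e0)
    then show "(\<lambda>n. f n \<omega>) \<longlonglongrightarrow> \<Theta> \<omega>" by simp
  qed
  moreover have "(\<lambda>n. integral\<^sup>L N (f n)) \<longlonglongrightarrow> \<alpha> * exp (- H0)"
    unfolding f by (intro tendsto_intros filterlim_compose[OF H0 e_right])
  ultimately show "integrable N \<Theta>" "(LINT \<omega>|N. \<Theta> \<omega>) = \<alpha> * exp (- H0)"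
    using integrable_monotone_convergence[of N f \<Theta>] integral_monotone_convergence[of N f \<Theta>] f(1) by auto
qed

lemma size_biased_yaglom:
  fixes N :: "'b measure"
  assumes \<alpha>: "0 < \<alpha>" and \<Theta>: "positive_random_variable N \<Theta>"
    and laplace: "\<And>s. 0 < s \<Longrightarrow> (LINT \<omega>|N. exp (- s * \<Theta> \<omega>)) = 1 - exp (- \<alpha> * \<Phi> s)"
    and H0: "(exponent_potential \<longlongrightarrow> H0) (at_right 0)"
  defines "\<mu> \<equiv> density (distr N borel \<Theta>) (\<lambda>r. ennreal (r / (LINT \<omega>|N. \<Theta> \<omega>)))"
  shows "real_distribution \<mu>" "AE r in \<mu>. 0 < r"
    "0 < s \<Longrightarrow> (LINT r|\<mu>. exp (- s * r)) = exp (H0 - exponent_potential s)"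
proof -
  define m where "m = (LINT \<omega>|N. \<Theta> \<omega>)"
  have m: "integrable N \<Theta>" "m = \<alpha> * exp (- H0)"
    unfolding m_def by (rule yaglom_mean[OF \<Theta> laplace H0]; assumption)+
  have m0: "0 < m" using \<alpha> by (simp add: m)
  have [measurable]: "\<Theta> \<in> borel_measurable N" and pos: "AE \<omega> in N. 0 < \<Theta> \<omega>"
    using \<Theta> by (auto simp: positive_random_variable_def)
  have posd: "AE r in distr N borel \<Theta>. 0 < r" using pos by (subst AE_distr_iff) auto
  have \<mu>: "\<mu> = density (distr N borel \<Theta>) (\<lambda>r. ennreal (r / m))" by (simp add: \<mu>_def m_def)
  have "emeasure \<mu> UNIV = (\<integral>\<^sup>+\<omega>. ennreal (\<Theta> \<omega> / m) \<partial>N)"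
    unfolding \<mu> by (subst emeasure_density) (auto simp: nn_integral_distr)
  also have "\<dots> = ennreal (LINT \<omega>|N. \<Theta> \<omega> / m)"
    by (rule nn_integral_eq_integral) (use m m0 pos in \<open>auto elim!: eventually_mono\<close>)
  also have "(LINT \<omega>|N. \<Theta> \<omega> / m) = 1" using m0 by (simp add: m_def)
  finally have 1: "emeasure \<mu> UNIV = 1" by simp
  show "real_distribution \<mu>"
    unfolding real_distribution_def real_distribution_axioms_def
    by (auto intro!: prob_spaceI simp: 1) (simp_all add: \<mu> 1[unfolded \<mu>])
  show "AE r in \<mu>. 0 < r"
    unfolding \<mu> using posd by (subst AE_density) (auto elim!: eventually_mono)
  show "(LINT r|\<mu>. exp (- s * r)) = exp (H0 - exponent_potential s)" if s: "0 < s"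
  proof -
    have "(LINT r|\<mu>. exp (- s * r)) = (LINT r|distr N borel \<Theta>. r / m * exp (- s * r))"
      unfolding \<mu> using posd m0 by (subst integral_density) (auto elim!: eventually_mono)
    also have "\<dots> = (LINT \<omega>|N. \<Theta> \<omega> * exp (- s * \<Theta> \<omega>)) / m"
      by (subst integral_distr) auto
    also have "\<dots> = \<alpha> * exp (- exponent_potential s) / m"
      using yaglom_derivative(2)[OF \<Theta> laplace s] by simp
    finally show ?thesis using \<alpha> by (simp add: m exp_diff exp_minus field_simps)
  qed
qed

lemma log_derivative_cong:
  "set_integrable lborel {0<..<u} (\<lambda>s. (deriv \<psi> s - \<alpha>) / \<psi> s) = set_integrable lborel {0<..<u} exponent_rate"
  "(LINT s:{0<..<u}|lborel. (deriv \<psi> s - \<alpha>) / \<psi> s) = (LINT s:{0<..<u}|lborel. exponent_rate s)"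
  by (intro set_integrable_cong set_lebesgue_integral_cong; auto simp: exponent_rate_def DERIV_imp_deriv[OF psi_deriv])+

end

section \<open>The limit law\<close>

theorem proposition4p8:
  fixes \<alpha> \<sigma> :: real and \<pi> :: "real measure" and W W' :: "real \<Rightarrow> real"
    and P :: "real \<Rightarrow> 'a measure" and V :: "real \<Rightarrow> 'a \<Rightarrow> real"
    and N :: "'b measure" and \<Theta> :: "'b \<Rightarrow> real"
  assumes branching: "branching_mechanism \<alpha> \<sigma> \<pi>"
    and scale: "scale_function (psi \<alpha> \<sigma> \<pi>) W"
    and W_deriv: "\<And>x. x > 0 \<Longrightarrow> (W has_real_derivative W' x) (at x)"
    and W_deriv_cont: "continuous_on {0<..} W'"
    and V_positive: "\<And>q. q > 0 \<Longrightarrow> positive_random_variable (P q) (V q)"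
    and V_laplace: "\<And>q s. q > 0 \<Longrightarrow> s > 0 \<Longrightarrow>
      (LINT \<omega>|P q. exp (- s * V q \<omega>)) =
        exp (- \<alpha> * (phi \<alpha> \<sigma> \<pi> (s + varphi \<alpha> \<sigma> \<pi> q) - q))
          * (psi \<alpha> \<sigma> \<pi> (varphi \<alpha> \<sigma> \<pi> q) / psi \<alpha> \<sigma> \<pi> (s + varphi \<alpha> \<sigma> \<pi> q))"
    and Theta_positive: "\<alpha> > 0 \<Longrightarrow> positive_random_variable N \<Theta>"
    and Theta_laplace: "\<And>s. \<alpha> > 0 \<Longrightarrow> s > 0 \<Longrightarrow>
      (LINT \<omega>|N. exp (- s * \<Theta> \<omega>)) = 1 - exp (- \<alpha> * phi \<alpha> \<sigma> \<pi> s)"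
  shows "(log_condition \<alpha> \<pi> \<longrightarrow>
      (\<exists>\<mu>. real_distribution \<mu> \<and> (AE r in \<mu>. 0 < r) \<and>
        weak_conv_at_top (\<lambda>q. distr (P q) borel (V q)) \<mu> \<and>
        \<comment> \<open>(i)\<close>
        integrable N \<Theta> \<and> 0 < (LINT \<omega>|N. \<Theta> \<omega>) \<and>
        \<mu> = density (distr N borel \<Theta>) (\<lambda>r. ennreal (r / (LINT \<omega>|N. \<Theta> \<omega>))) \<and>
        \<comment> \<open>(ii)\<close>
        infinitely_divisible \<mu> \<and>
        \<comment> \<open>(iii)\<close>
        (\<forall>u>0. set_integrable lborel {0<..<u}
                  (\<lambda>s. (deriv (psi \<alpha> \<sigma> \<pi>) s - \<alpha>) / psi \<alpha> \<sigma> \<pi> s) \<and>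
               laplace_exponent \<mu> u =
                  (LINT s:{0<..<u}|lborel. (deriv (psi \<alpha> \<sigma> \<pi>) s - \<alpha>) / psi \<alpha> \<sigma> \<pi> s)) \<and>
        \<comment> \<open>(iv)\<close>
        (\<forall>x>0. set_integrable \<pi> {0<..} (\<lambda>r. (W x - W (x - r)) * r)) \<and>
        levy_khintchine (laplace_exponent \<mu>) 0 (\<lambda>x. v_infinity \<sigma> \<pi> W W' x / x)))
    \<and> (\<not> log_condition \<alpha> \<pi> \<longrightarrow>
      (\<forall>M>0. ((\<lambda>q. measure (P q) {\<omega> \<in> space (P q). V q \<omega> > M}) \<longlongrightarrow> 1) at_top))"
proof -
  interpret branching_mechanism \<alpha> \<sigma> \<pi> by (rule branching)
  interpret differentiable_scale_function \<alpha> \<sigma> \<pi> W W'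
    by unfold_locales (fact scale W_deriv W_deriv_cont)+
  define L where "L q = distr (P q) borel (V q)" for q
  have L: "real_distribution (L q)" "AE x in L q. 0 \<le> x" if "0 < q" for q
    unfolding L_def by (rule positive_random_variable_law[OF V_positive[OF that]])+
  have L_laplace: "eventually (\<lambda>q. exp (exponent_potential (varphi \<alpha> \<sigma> \<pi> q) - exponent_potential (s + varphi \<alpha> \<sigma> \<pi> q)) = (LINT x|L q. exp (- s * x))) at_top"
    if s: "0 < s" for s
    using eventually_gt_at_top[of 0] eventually_ge_at_top[of "\<Phi> 1"]
  proof eventually_elim
    case (elim q)
    then show ?case
      unfolding L_def positive_random_variable_law(3)[OF V_positive[OF elim(1)]] V_laplace[OF elim(1) s]
      using conditioned_laplace_eq[OF elim(2) s] by simp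
  qed
  show ?thesis
  proof (intro conjI impI)
    assume log: "log_condition \<alpha> \<pi>"
    then have \<alpha>: "0 < \<alpha>" by (simp add: log_condition_def)
    obtain H0 where H0: "(exponent_potential \<longlongrightarrow> H0) (at_right 0)"
      and exponent_rate_int: "\<And>u. 0 < u \<Longrightarrow> set_integrable lborel {0<..<u} exponent_rate"
      and exponent_rate_val: "\<And>u. 0 < u \<Longrightarrow> (LINT s:{0<..<u}|lborel. exponent_rate s) = exponent_potential u - H0"
      using log exponent_potential_limit unfolding log_condition_iff by metis
    define \<mu> where "\<mu> = density (distr N borel \<Theta>) (\<lambda>r. ennreal (r / (LINT \<omega>|N. \<Theta> \<omega>)))"
    note sb = size_biased_yaglom[OF \<alpha> Theta_positive[OF \<alpha>] Theta_laplace[OF \<alpha>] H0, folded \<mu>_def]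
    note mean = yaglom_mean[OF Theta_positive[OF \<alpha>] Theta_laplace[OF \<alpha>] H0]
    have \<mu>: "real_distribution \<mu>" "AE r in \<mu>. 0 < r" by (rule sb; assumption)+
    have \<mu>0: "AE r in \<mu>. 0 \<le> r" using \<mu>(2) by eventually_elim simp
    have \<mu>_laplace: "(LINT r|\<mu>. exp (- s * r)) = exp (H0 - exponent_potential s)" if "0 < s" for s
      by (rule sb(3)) (use that in auto)
    have l: "laplace_exponent \<mu> u = (LINT s:{0<..<u}|lborel. exponent_rate s)" if "0 < u" for u
      unfolding laplace_exponent_def \<mu>_laplace[OF that] exponent_rate_val[OF that] by simp
    have weak: "weak_conv_at_top L \<mu>"
    proof (rule laplace_tendsto_imp_weak_conv_at_top[OF L \<mu>(1) \<mu>0])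
      fix s :: real assume s: "0 < s"
      have "((\<lambda>e. exp (exponent_potential e - exponent_potential (s + e))) \<longlongrightarrow> exp (H0 - exponent_potential s)) (at_right 0)"
        by (intro tendsto_intros H0 exponent_potential_shift_tendsto s)
      from filterlim_compose[OF this varphi_tendsto]
      show "((\<lambda>q. LINT x|L q. exp (- s * x)) \<longlongrightarrow> (LINT x|\<mu>. exp (- s * x))) at_top"
        unfolding \<mu>_laplace[OF s] by (rule Lim_transform_eventually[OF _ L_laplace[OF s]])
    qed
    have lk: "levy_khintchine (laplace_exponent \<mu>) 0 (\<lambda>x. v_infinity \<sigma> \<pi> W W' x / x)"
      by (rule v_levy_khintchine[OF exponent_rate_int l])
    show "\<exists>\<mu>. real_distribution \<mu> \<and> (AE r in \<mu>. 0 < r) \<and>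
        weak_conv_at_top (\<lambda>q. distr (P q) borel (V q)) \<mu> \<and>
        integrable N \<Theta> \<and> 0 < (LINT \<omega>|N. \<Theta> \<omega>) \<and>
        \<mu> = density (distr N borel \<Theta>) (\<lambda>r. ennreal (r / (LINT \<omega>|N. \<Theta> \<omega>))) \<and>
        infinitely_divisible \<mu> \<and>
        (\<forall>u>0. set_integrable lborel {0<..<u}
                  (\<lambda>s. (deriv (psi \<alpha> \<sigma> \<pi>) s - \<alpha>) / psi \<alpha> \<sigma> \<pi> s) \<and>
               laplace_exponent \<mu> u =
                  (LINT s:{0<..<u}|lborel. (deriv (psi \<alpha> \<sigma> \<pi>) s - \<alpha>) / psi \<alpha> \<sigma> \<pi> s)) \<and>
        (\<forall>x>0. set_integrable \<pi> {0<..} (\<lambda>r. (W x - W (x - r)) * r)) \<and>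
        levy_khintchine (laplace_exponent \<mu>) 0 (\<lambda>x. v_infinity \<sigma> \<pi> W W' x / x)"
    proof (intro exI[of _ \<mu>] conjI allI impI)
      show "weak_conv_at_top (\<lambda>q. distr (P q) borel (V q)) \<mu>" using weak by (simp add: L_def[abs_def])
      show "integrable N \<Theta>" by (rule mean(1))
      show "0 < (LINT \<omega>|N. \<Theta> \<omega>)" using mean(2) \<alpha> by simp
      show "infinitely_divisible \<mu>" by (rule levy_khintchine_imp_infinitely_divisible[OF \<mu>(1) \<mu>0 lk])
    qed (use \<mu> \<mu>_def lk exponent_rate_int l W_increment_integrable log_derivative_cong in auto)
  next
    assume "\<not> log_condition \<alpha> \<pi>"
    then have bot: "filterlim exponent_potential at_bot (at_right 0)" by (intro exponent_potential_at_bot) (simp add: log_condition_iff)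
    show "\<forall>M>0. ((\<lambda>q. measure (P q) {\<omega> \<in> space (P q). V q \<omega> > M}) \<longlongrightarrow> 1) at_top"
    proof (intro allI impI)
      fix M :: real assume M: "0 < M"
      define s where "s = 1 / M"
      have s: "0 < s" using M by (simp add: s_def)
      have "filterlim (\<lambda>e. exponent_potential (s + e) + - exponent_potential e) at_top (at_right 0)"
        by (rule filterlim_tendsto_add_at_top[OF exponent_potential_shift_tendsto[OF s] bot[unfolded filterlim_uminus_at_bot]])
      then have "filterlim (\<lambda>e. exponent_potential e - exponent_potential (s + e)) at_bot (at_right 0)"
        by (simp add: filterlim_uminus_at_bot)
      then have "((\<lambda>e. exp (exponent_potential e - exponent_potential (s + e))) \<longlongrightarrow> 0) (at_right 0)"
        by (rule filterlim_compose[OF exp_at_bot])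
      from filterlim_compose[OF this varphi_tendsto]
      have "((\<lambda>q. LINT x|L q. exp (- s * x)) \<longlongrightarrow> 0) at_top"
        by (rule Lim_transform_eventually[OF _ L_laplace[OF s]])
      then have lim: "((\<lambda>q. 1 - exp 1 * (LINT x|L q. exp (- s * x))) \<longlongrightarrow> 1) at_top"
        by (auto intro!: tendsto_eq_intros)
      have bound: "1 - exp 1 * (LINT x|L q. exp (- s * x)) \<le> measure (P q) {\<omega> \<in> space (P q). V q \<omega> > M}"
        and le1: "measure (P q) {\<omega> \<in> space (P q). V q \<omega> > M} \<le> 1" if q: "0 < q" for q
      proof -
        interpret Pq: prob_space "P q" using V_positive[OF q] by (simp add: positive_random_variable_def)
        interpret Lq: real_distribution "L q" by (rule L(1)[OF q])
        have "V q \<in> borel_measurable (P q)" using V_positive[OF q] by (simp add: positive_random_variable_def)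
        then have "measure (P q) {\<omega> \<in> space (P q). V q \<omega> > M} = measure (L q) {M<..}"
          unfolding L_def by (subst measure_distr) (auto intro!: arg_cong[of _ _ "measure (P q)"])
        also have "{M<..} = space (L q) - {..M}" by auto
        also have "measure (L q) (space (L q) - {..M}) = 1 - measure (L q) {..M}"
          by (rule Lq.prob_compl) simp
        finally show "1 - exp 1 * (LINT x|L q. exp (- s * x)) \<le> measure (P q) {\<omega> \<in> space (P q). V q \<omega> > M}"
          using laplace_head_bound[OF L[OF q] s] by (simp add: s_def)
        show "measure (P q) {\<omega> \<in> space (P q). V q \<omega> > M} \<le> 1" by (rule Pq.prob_le_1)
      qed
      show "((\<lambda>q. measure (P q) {\<omega> \<in> space (P q). V q \<omega> > M}) \<longlongrightarrow> 1) at_top"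
        by (rule tendsto_sandwich[OF _ _ lim tendsto_const])
          (use bound le1 in \<open>auto intro!: eventually_mono[OF eventually_gt_at_top[of 0]]\<close>)
    qed
  qed
qed

end
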